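(* Let $m\ge 1$ be the number of identical machines, and let $J$ be a finite nonempty set of $n$ jobs, where job $j\in J$ has rational processing time $p_j>0$, cooling rate $\alpha_j<0$ and heating rate $\beta_j>0$. Let $C_{\max}$ denote the minimum makespan of this instance on $m$ machines, and for $j\in J$ let $q_j$ denote the minimum makespan of the instance consisting solely of job $j$. Then $$C_{\max}=\max\Big\{\max_{j\in J}q_j,\ \frac{\sum_{j\in J}p_j}{m}\Big\},$$ and $C_{\max}$ can be computed from the input $m$, $(p_j,\alpha_j,\beta_j)_{j\in J}$ in linear time, i.e. in $O(n)$ time (counting arithmetic operations and comparisons as unit cost).
   Context: A schedule $S=(S_j:j\in J)$ for a finite set of jobs $J$ consists of a load function $S_j:\mathbb{R}_+\to\mathbb{R}_+$ for each job $j$ (where $\mathbb{R}_+=[0,\infty)$), assumed (locally) integrable; $S_j(t)$ is the fractional load of job $j$ at time $t$. The schedule is manageable on $m$ machines if for all $t\ge 0$ we have $\sum_{j\in J}S_j(t)\le m$ and $S_j(t)\le 1$ for every $j\in J$ (a job is never processed by more than one machine at a time). A schedule determines for each job $j$ a temperature $T_j:\mathbb{R}_+\to\mathbb{R}_+$, the (absolutely continuous) function with $T_j(0)=0$ and, for (almost every) $t$, $$\frac{\partial}{\partial t}T_j(t)=\begin{cases}\alpha_j(1-S_j(t))+\beta_j S_j(t) & \text{if } T_j(t)>0,\\ \max\{0,\alpha_j(1-S_j(t))+\beta_j S_j(t)\} & \text{if } T_j(t)=0.\end{cases}$$ The schedule is feasible for $m$ machines if it is manageable on $m$ machines and $T_j(t)\le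 1$ for all $j\in J$, $t\ge 0$. The completion time of job $j$ is $C_j(S)=\min\{t\in\mathbb{R}_+: p_j\le \int_0^t S_j(s)\,ds\}$, and the makespan of $S$ is $\max_{j\in J}C_j(S)$. Only schedules in which every job is completed are considered. A schedule is natural if $S_j(t)\in\{0,1\}$ for all $j,t$ and each set $\{t:S_j(t)=1\}$ is a union of half-open intervals $[t,t')$. The minimum makespan of an instance means the infimum of the makespan over all feasible natural schedules (the infimum need not be attained by a natural schedule). *)

theory Defs
  imports "HOL-Analysis.Analysis" "HOL-Library.Landau_Symbols"
begin

section \<open>Schedules with temperatures\<close>

text \<open>
  Functions on the half-line \<open>[0, \<infinity>)\<close> are represented by functions on all of \<open>real\<close> whose values
  at negative arguments are never inspected.
\<close>

text \<open>
  Absolute continuity on an interval \<open>I\<close>. Members \<open>(x, y)\<close> of \<open>D\<close> are intervals with disjoint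
  interiors.
\<close>

definition abs_continuous_on :: "real set \<Rightarrow> (real \<Rightarrow> real) \<Rightarrow> bool" where
  "abs_continuous_on I f \<longleftrightarrow>
     (\<forall>\<epsilon>>0. \<exists>\<delta>>0. \<forall>D :: (real \<times> real) set.
        finite D \<and> (\<forall>(x, y)\<in>D. x \<le> y \<and> {x..y} \<subseteq> I) \<and>
        disjoint_family_on (\<lambda>(x, y). {x<..<y}) D \<and> (\<Sum>(x, y)\<in>D. y - x) < \<delta>
        \<longrightarrow> (\<Sum>(x, y)\<in>D. \<bar>f y - f x\<bar>) < \<epsilon>)"

definition is_schedule :: "'j set \<Rightarrow> ('j \<Rightarrow> real \<Rightarrow> real) \<Rightarrow> bool" where
  "is_schedule J S \<longleftrightarrow>
     (\<forall>j\<in>J. \<forall>t\<ge>0. 0 \<le> S j t \<and> S j absolutely_integrable_on {0..t})"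

definition manageable :: "nat \<Rightarrow> 'j set \<Rightarrow> ('j \<Rightarrow> real \<Rightarrow> real) \<Rightarrow> bool" where
  "manageable m J S \<longleftrightarrow>
     (\<forall>t\<ge>0. (\<Sum>j\<in>J. S j t) \<le> real m \<and> (\<forall>j\<in>J. S j t \<le> 1))"

definition temp_rate :: "real \<Rightarrow> real \<Rightarrow> real \<Rightarrow> real \<Rightarrow> real" where
  "temp_rate a b s x =
     (if x > 0 then a * (1 - s) + b * s else max 0 (a * (1 - s) + b * s))"

text \<open>
  \<open>is_temperature a b s T\<close>: \<open>T\<close> is the temperature of a job with cooling rate \<open>a\<close>, heating rate \<open>b\<close>
  and load function \<open>s\<close>. These conditions determine \<open>T\<close> uniquely on \<open>[0, \<infinity>)\<close>.
\<close>

definition is_temperature :: "real \<Rightarrow> real \<Rightarrow> (real \<Rightarrow> real) \<Rightarrow> (real \<Rightarrow> real) \<Rightarrow> bool" where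
  "is_temperature a b s T \<longleftrightarrow>
     T 0 = 0 \<and> (\<forall>t\<ge>0. 0 \<le> T t) \<and>
     (\<forall>t\<ge>0. abs_continuous_on {0..t} T) \<and>
     (AE t in lebesgue. 0 \<le> t \<longrightarrow>
        (T has_real_derivative temp_rate a b (s t) (T t)) (at t within {0..}))"

definition feasible ::
  "nat \<Rightarrow> 'j set \<Rightarrow> ('j \<Rightarrow> real) \<Rightarrow> ('j \<Rightarrow> real) \<Rightarrow> ('j \<Rightarrow> real \<Rightarrow> real) \<Rightarrow> bool" where
  "feasible m J \<alpha> \<beta> S \<longleftrightarrow>
     is_schedule J S \<and> manageable m J S \<and>
     (\<forall>j\<in>J. \<exists>T. is_temperature (\<alpha> j) (\<beta> j) (S j) T \<and> (\<forall>t\<ge>0. T t \<le> 1))"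

text \<open>The union of half-open intervals may have infinitely many members.\<close>

definition natural_schedule :: "'j set \<Rightarrow> ('j \<Rightarrow> real \<Rightarrow> real) \<Rightarrow> bool" where
  "natural_schedule J S \<longleftrightarrow>
     (\<forall>j\<in>J. (\<forall>t\<ge>0. S j t \<in> {0, 1}) \<and>
        (\<exists>I :: (real \<times> real) set. {t. 0 \<le> t \<and> S j t = 1} = (\<Union>(a, b)\<in>I. {a..<b})))"

definition completes :: "'j set \<Rightarrow> ('j \<Rightarrow> real) \<Rightarrow> ('j \<Rightarrow> real \<Rightarrow> real) \<Rightarrow> bool" where
  "completes J p S \<longleftrightarrow> (\<forall>j\<in>J. \<exists>t\<ge>0. p j \<le> integral {0..t} (S j))"

definition completion_time :: "('j \<Rightarrow> real) \<Rightarrow> ('j \<Rightarrow> real \<Rightarrow> real) \<Rightarrow> 'j \<Rightarrow> real" where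
  "completion_time p S j = (LEAST t. 0 \<le> t \<and> p j \<le> integral {0..t} (S j))"

definition makespan :: "'j set \<Rightarrow> ('j \<Rightarrow> real) \<Rightarrow> ('j \<Rightarrow> real \<Rightarrow> real) \<Rightarrow> real" where
  "makespan J p S = (MAX j\<in>J. completion_time p S j)"

text \<open>
  The infimum need not be attained. The set is bounded below by 0, and on valid inputs it is
  nonempty because a job may be processed arbitrarily slowly on average.
\<close>

definition min_makespan ::
  "nat \<Rightarrow> 'j set \<Rightarrow> ('j \<Rightarrow> real) \<Rightarrow> ('j \<Rightarrow> real) \<Rightarrow> ('j \<Rightarrow> real) \<Rightarrow> real" where
  "min_makespan m J p \<alpha> \<beta> =
     Inf {makespan J p S | S. feasible m J \<alpha> \<beta> S \<and> natural_schedule J S \<and> completes J p S}"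

definition valid_input ::
  "nat \<Rightarrow> 'j set \<Rightarrow> ('j \<Rightarrow> real) \<Rightarrow> ('j \<Rightarrow> real) \<Rightarrow> ('j \<Rightarrow> real) \<Rightarrow> bool" where
  "valid_input m J p \<alpha> \<beta> \<longleftrightarrow>
     1 \<le> m \<and> finite J \<and> J \<noteq> {} \<and>
     (\<forall>j\<in>J. p j \<in> \<rat> \<and> 0 < p j \<and> \<alpha> j < 0 \<and> 0 < \<beta> j)"


section \<open>Random access machines with unit-cost arithmetic\<close>

text \<open>
  A machine has natural-number index registers, real number registers, and an array of real
  numbers that is addressed through index registers. Every instruction costs one time unit.
  There is no transfer from numbers to indices (in particular no rounding), numerical constants
  are rational, and the instructions on indices are limited to what addressing and loop control need.
  The machine stops as soon as the program counter leaves the program.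
\<close>

datatype instr =
    IConst nat nat | IMove nat nat | IAdd nat nat nat | ISub nat nat nat
  | RConst nat rat | RMove nat nat | RAdd nat nat nat | RSub nat nat nat
  | RMul nat nat nat | RDiv nat nat nat
  | Load nat nat | Store nat nat
  | Jump nat | IJumpLess nat nat nat | RJumpLess nat nat nat

type_synonym program = "instr list"

record state =
  pc :: nat
  ireg :: "nat \<Rightarrow> nat"
  rreg :: "nat \<Rightarrow> real"
  arr :: "nat \<Rightarrow> real"

definition set_ireg :: "nat \<Rightarrow> nat \<Rightarrow> state \<Rightarrow> state" where
  "set_ireg d v \<sigma> = \<sigma>\<lparr>ireg := (ireg \<sigma>)(d := v), pc := Suc (pc \<sigma>)\<rparr>"

definition set_rreg :: "nat \<Rightarrow> real \<Rightarrow> state \<Rightarrow> state" where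
  "set_rreg d v \<sigma> = \<sigma>\<lparr>rreg := (rreg \<sigma>)(d := v), pc := Suc (pc \<sigma>)\<rparr>"

definition branch :: "bool \<Rightarrow> nat \<Rightarrow> state \<Rightarrow> state" where
  "branch c l \<sigma> = \<sigma>\<lparr>pc := (if c then l else Suc (pc \<sigma>))\<rparr>"

text \<open>\<open>ISub\<close> is truncated subtraction, and \<open>RDiv\<close> by zero yields zero.\<close>

fun exec :: "instr \<Rightarrow> state \<Rightarrow> state" where
  "exec (IConst d k) \<sigma> = set_ireg d k \<sigma>"
| "exec (IMove d a) \<sigma> = set_ireg d (ireg \<sigma> a) \<sigma>"
| "exec (IAdd d a b) \<sigma> = set_ireg d (ireg \<sigma> a + ireg \<sigma> b) \<sigma>"
| "exec (ISub d a b) \<sigma> = set_ireg d (ireg \<sigma> a - ireg \<sigma> b) \<sigma>"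
| "exec (RConst d c) \<sigma> = set_rreg d (of_rat c) \<sigma>"
| "exec (RMove d a) \<sigma> = set_rreg d (rreg \<sigma> a) \<sigma>"
| "exec (RAdd d a b) \<sigma> = set_rreg d (rreg \<sigma> a + rreg \<sigma> b) \<sigma>"
| "exec (RSub d a b) \<sigma> = set_rreg d (rreg \<sigma> a - rreg \<sigma> b) \<sigma>"
| "exec (RMul d a b) \<sigma> = set_rreg d (rreg \<sigma> a * rreg \<sigma> b) \<sigma>"
| "exec (RDiv d a b) \<sigma> = set_rreg d (rreg \<sigma> a / rreg \<sigma> b) \<sigma>"
| "exec (Load d i) \<sigma> = set_rreg d (arr \<sigma> (ireg \<sigma> i)) \<sigma>"
| "exec (Store i a) \<sigma> = \<sigma>\<lparr>arr := (arr \<sigma>)(ireg \<sigma> i := rreg \<sigma> a), pc := Suc (pc \<sigma>)\<rparr>"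
| "exec (Jump l) \<sigma> = branch True l \<sigma>"
| "exec (IJumpLess a b l) \<sigma> = branch (ireg \<sigma> a < ireg \<sigma> b) l \<sigma>"
| "exec (RJumpLess a b l) \<sigma> = branch (rreg \<sigma> a < rreg \<sigma> b) l \<sigma>"

definition halted :: "program \<Rightarrow> state \<Rightarrow> bool" where
  "halted P \<sigma> \<longleftrightarrow> length P \<le> pc \<sigma>"

definition step :: "program \<Rightarrow> state \<Rightarrow> state" where
  "step P \<sigma> = (if halted P \<sigma> then \<sigma> else exec (P ! pc \<sigma>) \<sigma>)"

text \<open>The input is stored in the array, and its length in index register 0.\<close>

definition initial_state :: "real list \<Rightarrow> state" where
  "initial_state xs =
     \<lparr>pc = 0, ireg = (\<lambda>_. 0)(0 := length xs), rreg = (\<lambda>_. 0),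
      arr = (\<lambda>i. if i < length xs then xs ! i else 0)\<rparr>"

text \<open>The result is read off number register 0.\<close>

definition computes_within :: "program \<Rightarrow> real list \<Rightarrow> real \<Rightarrow> nat \<Rightarrow> bool" where
  "computes_within P xs y k \<longleftrightarrow>
     (let \<sigma> = (step P ^^ k) (initial_state xs) in halted P \<sigma> \<and> rreg \<sigma> 0 = y)"

definition encode_input ::
  "nat \<Rightarrow> ('j \<Rightarrow> real) \<Rightarrow> ('j \<Rightarrow> real) \<Rightarrow> ('j \<Rightarrow> real) \<Rightarrow> 'j list \<Rightarrow> real list" where
  "encode_input m p \<alpha> \<beta> js = real m # concat (map (\<lambda>j. [p j, \<alpha> j, \<beta> j]) js)"

end

theory Submission
  imports Defs
begin

text \<open>
  Write \<open>B\<close> for the larger of the average machine load and the largest bound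
  \<open>single_job_bound\<close>, which for one job with rates \<open>a\<close>, \<open>b\<close> and processing time \<open>p\<close> is the larger of
  \<open>p\<close> and the least \<open>t\<close> with \<open>a * t + (b - a) * p \<le> 1\<close>. Everything rests on the equality of the
  minimum makespan with \<open>B\<close>: for a single job it says that \<open>q\<^sub>j\<close> is the \<open>single_job_bound\<close>, so the
  claimed formula follows, and since \<open>B\<close> is a rational expression with maxima in the input, one pass
  over the jobs computes it.

  No schedule finishes before \<open>B\<close> (\<open>makespan_ge\<close>). Without the reflection at 0 the temperature after
  time \<open>t\<close> and work \<open>w\<close> would be \<open>a * t + (b - a) * w\<close>, and the reflection can only raise it. As the
  temperature never exceeds 1, a completed job forces \<open>a * t + (b - a) * p \<le> 1\<close>. Temperatures are only
  known to be absolutely continuous with a prescribed derivative almost everywhere, so this comparison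
  needs the fundamental theorem of calculus in that generality
  (\<open>fundamental_theorem_of_calculus_abs_continuous\<close>).

  Conversely (\<open>exists_schedule_near_bound\<close>), let \<open>C\<close> be slightly larger than \<open>B\<close>. Giving each job the
  constant fractional load \<open>p / C\<close> would finish all jobs at time \<open>C\<close>; the machines suffice because
  \<open>C\<close> exceeds the average load, and all temperatures stay strictly below 1 because \<open>C\<close> exceeds the
  single-job bounds. To obtain loads 0 and 1, time is cut into short slices of length \<open>h\<close>, and in each
  slice the jobs are placed by McNaughton's wrap-around rule: lay the lengths \<open>p * h / C\<close> end to end on
  a line and cut it into pieces of length \<open>h\<close>, one for each machine. Counting the integers \<open>k\<close> for which
  \<open>t / h + k\<close> falls into \<open>[y, y')\<close> turns this rule into the formula \<open>\<lceil>y' - t / h\<rceil> - \<lceil>y - t / h\<rceil>\<close>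
  (\<open>wrap_load\<close>), whose sum over all jobs telescopes. On every interval the work differs from that of
  the constant load by at most \<open>h\<close>, which raises the temperature by at most \<open>(b - a) * h\<close>; for small
  \<open>h\<close> this fits into the strict gap. The temperature itself is the largest increment, over intervals
  that end at the present moment, of the temperature without reflection (locale \<open>on_off_load\<close>).
\<close>

section \<open>The fundamental theorem of calculus for absolutely continuous functions\<close>

lemma sum_measure_tagged_partial_division:
  fixes p :: "(real \<times> real set) set"
  assumes p: "p tagged_partial_division_of i" and U: "\<And>x K. (x, K) \<in> p \<Longrightarrow> K \<subseteq> U"
    and "U \<in> lmeasurable"
  shows "(\<Sum>(x, K)\<in>p. Sup K - Inf K) \<le> measure lebesgue U"
proof -
  have fin: "finite p" using p by (rule tagged_partial_division_ofD)
  have cb: "\<exists>u v. K = {u..v} \<and> u \<le> v" if "(x, K) \<in> p" for x K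
    using tagged_partial_division_ofD(2,4)[OF p that] by (metis atLeastAtMost_iff box_real(2) order_trans)
  have "(\<Sum>(x, K)\<in>p. Sup K - Inf K) = (\<Sum>z\<in>p. measure lebesgue (snd z))"
  proof (rule sum.cong[OF refl])
    fix z assume "z \<in> p"
    then obtain x K where z: "z = (x, K)" "(x, K) \<in> p" by (metis surj_pair)
    obtain u v where "K = {u..v}" "u \<le> v" using cb[OF z(2)] by auto
    then show "(case z of (x, K) \<Rightarrow> Sup K - Inf K) = measure lebesgue (snd z)"
      by (simp add: z)
  qed
  also have "\<dots> = measure lebesgue (\<Union>(snd ` p))"
  proof (rule measure_negligible_finite_Union_image[symmetric, OF fin])
    show "snd z \<in> lmeasurable" if "z \<in> p" for z
      using cb[of "fst z" "snd z"] that by auto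
    show "pairwise (\<lambda>x y. negligible (snd x \<inter> snd y)) p"
    proof (rule pairwiseI)
      fix y z assume "y \<in> p" "z \<in> p" "y \<noteq> z"
      then have "interior (snd y) \<inter> interior (snd z) = {}"
        using tagged_partial_division_ofD(5)[OF p, of "fst y" "snd y" "fst z" "snd z"] by auto
      moreover obtain u v u' v' where "snd y = {u..v}" "snd z = {u'..v'}"
        using cb[of "fst y" "snd y"] cb[of "fst z" "snd z"] \<open>y \<in> p\<close> \<open>z \<in> p\<close> by auto
      ultimately show "negligible (snd y \<inter> snd z)"
        by (simp add: Int_atLeastAtMost flip: interior_Int)
          (simp add: negligible_interval(1)[of "max u u'" "min v v'", simplified])
    qed
  qed
  also have "\<dots> \<le> measure lebesgue U"
  proof (rule measure_mono_fmeasurable)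
    show "\<Union> (snd ` p) \<subseteq> U" using U by force
    show "\<Union> (snd ` p) \<in> sets lebesgue"
      using cb fin by (intro sets.finite_Union) force+
  qed fact
  finally show ?thesis .
qed

text \<open>
  Absolute continuity speaks about sets of pairs of end points. Passing from a tagged division to its
  end points loses nothing: two members with the same interval and different tags would have to share
  interior points.
\<close>

lemma abs_continuous_on_tagged_sum:
  assumes ac: "abs_continuous_on {a..b} f" and "0 < e"
  obtains d where "0 < d"
    "\<And>p. p tagged_partial_division_of {a..b} \<Longrightarrow> (\<Sum>(x, K)\<in>p. Sup K - Inf K) < d
       \<Longrightarrow> (\<Sum>(x, K)\<in>p. \<bar>f (Sup K) - f (Inf K)\<bar>) < e"
proof -
  obtain d where "0 < d" and d: "\<forall>D :: (real \<times> real) set.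
        finite D \<and> (\<forall>(x, y)\<in>D. x \<le> y \<and> {x..y} \<subseteq> {a..b}) \<and>
        disjoint_family_on (\<lambda>(x, y). {x<..<y}) D \<and> (\<Sum>(x, y)\<in>D. y - x) < d
        \<longrightarrow> (\<Sum>(x, y)\<in>D. \<bar>f y - f x\<bar>) < e"
    using ac[unfolded abs_continuous_on_def, THEN spec, THEN mp, OF \<open>0 < e\<close>] by (elim exE conjE)
  show thesis
  proof (rule that[OF \<open>0 < d\<close>])
    fix p assume p: "p tagged_partial_division_of {a..b}"
      and small: "(\<Sum>(x, K)\<in>p. Sup K - Inf K) < d"
    define ends where "ends = (\<lambda>(x :: real, K :: real set). (Inf K, Sup K))"
    have cb: "\<exists>u v. K = {u..v} \<and> u \<le> x \<and> x \<le> v \<and> ends (x, K) = (u, v)" if xK: "(x, K) \<in> p" for x K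
    proof -
      obtain u v where uv: "K = {u..v}" 
        using tagged_partial_division_ofD(4)[OF p xK] by auto
      then have "u \<le> x" "x \<le> v" using tagged_partial_division_ofD(2)[OF p xK] by auto
      then show ?thesis using uv by (auto simp: ends_def)
    qed
    have disj: "{fst (ends y)<..<snd (ends y)} \<inter> {fst (ends z)<..<snd (ends z)} = {}"
      if "y \<in> p" "z \<in> p" "y \<noteq> z" for y z
    proof -
      obtain x K x' K' where yz: "y = (x, K)" "z = (x', K')" by (metis surj_pair)
      show ?thesis
        using tagged_partial_division_ofD(5)[OF p, of x K x' K'] cb[of x K] cb[of x' K'] that
        unfolding yz by auto
    qed
    have inj: "inj_on ends p"
    proof (rule inj_onI, rule ccontr)
      fix y z assume *: "y \<in> p" "z \<in> p" "ends y = ends z" "y \<noteq> z"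
      obtain x K x' K' where yz: "y = (x, K)" "z = (x', K')" by (metis surj_pair)
      obtain u v where K: "K = {u..v}" "u \<le> x" "x \<le> v" "ends (x, K) = (u, v)" using cb * yz by blast
      obtain u' v' where K': "K' = {u'..v'}" "u' \<le> x'" "x' \<le> v'" "ends (x', K') = (u', v')"
        using cb * yz by blast
      have eq: "u = u'" "v = v'" using * yz K K' by auto
      have "{u<..<v} = {}" using disj[OF *(1,2,4)] eq K K' yz by auto
      then have "u = v" using K by simp
      then show False using * K K' eq yz by auto
    qed
    have sums: "(\<Sum>(u, v)\<in>ends ` p. g v u) = (\<Sum>(x, K)\<in>p. g (Sup K) (Inf K))"
      for g :: "real \<Rightarrow> real \<Rightarrow> real"
      by (subst sum.reindex[OF inj]) (auto simp: ends_def intro!: sum.cong)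
    have "(\<Sum>(u, v)\<in>ends ` p. \<bar>f v - f u\<bar>) < e"
    proof (rule d[THEN spec, THEN mp], intro conjI)
      show "finite (ends ` p)" using tagged_partial_division_ofD(1)[OF p] by simp
      show "\<forall>(u, v)\<in>ends ` p. u \<le> v \<and> {u..v} \<subseteq> {a..b}"
      proof (rule ballI, clarify)
        fix u v x K assume xK: "(x, K) \<in> p" and uv: "(u, v) = ends (x, K)"
        show "u \<le> v \<and> {u..v} \<subseteq> {a..b}"
          using cb[OF xK] tagged_partial_division_ofD(3)[OF p xK] by (auto simp flip: uv)
      qed
      show "disjoint_family_on (\<lambda>(x, y). {x<..<y}) (ends ` p)"
        unfolding disjoint_family_on_def
      proof (intro ballI impI)
        fix m n assume "m \<in> ends ` p" "n \<in> ends ` p" "m \<noteq> n"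
        then obtain y z where yz: "y \<in> p" "z \<in> p" "y \<noteq> z" "m = ends y" "n = ends z" by blast
        then show "(case m of (x, y) \<Rightarrow> {x<..<y}) \<inter> (case n of (x, y) \<Rightarrow> {x<..<y}) = {}"
          using disj[OF yz(1-3)] by (simp only: case_prod_unfold yz(4,5))
      qed
      show "(\<Sum>(x, y)\<in>ends ` p. y - x) < d"
        using small sums[of "\<lambda>v u. v - u"] by simp
    qed
    then show "(\<Sum>(x, K)\<in>p. \<bar>f (Sup K) - f (Inf K)\<bar>) < e"
      using sums[of "\<lambda>v u. \<bar>f v - f u\<bar>"] by simp
  qed
qed

text \<open>
  In a fine tagged division, intervals tagged outside \<open>N\<close> are handled by the derivative as usual.
  Those tagged in \<open>N\<close> lie in an open set of small measure if the gauge is small there, and hence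
  contribute little to the variation of \<open>f\<close> by absolute continuity.
\<close>

theorem fundamental_theorem_of_calculus_abs_continuous:
  fixes f :: "real \<Rightarrow> real"
  assumes ab: "a \<le> b" and ac: "abs_continuous_on {a..b} f" and N: "negligible N"
    and deriv: "\<And>x. x \<in> {a..b} - N \<Longrightarrow> (f has_real_derivative f' x) (at x within {a..b})"
  shows "(f' has_integral (f b - f a)) {a..b}"
proof -
  \<comment> \<open>The values on the negligible set \<open>N\<close> are irrelevant to the integral; 0 removes these terms from
    Riemann sums.\<close>
  define g where "g x = (if x \<in> N then 0 else f' x)" for x
  have "(g has_integral (f b - f a)) {a..b}"
    unfolding has_integral_real
  proof (intro allI impI)
    fix e :: real assume "0 < e"
    define e' where "e' = e / (2 * (b - a + 1))"
    have "0 < e'" "e' * (b - a) < e / 2" using \<open>0 < e\<close> ab by (auto simp: e'_def field_simps)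
    have "\<exists>d>0. x \<in> {a..b} - N \<longrightarrow> (\<forall>y\<in>{a..b}. \<bar>y - x\<bar> < d \<longrightarrow>
             \<bar>f y - f x - f' x * (y - x)\<bar> \<le> e' * \<bar>y - x\<bar>)" for x
    proof (cases "x \<in> {a..b} - N")
      case True
      show ?thesis
        using deriv[OF True, unfolded has_field_derivative_def has_derivative_within_alt,
            THEN conjunct2, rule_format, OF \<open>0 < e'\<close>]
        unfolding real_norm_def by blast
    qed (auto intro: exI[of _ 1])
    then obtain d where d: "\<And>x. 0 < d x"
      "\<And>x y. \<lbrakk>x \<in> {a..b} - N; y \<in> {a..b}; \<bar>y - x\<bar> < d x\<rbrakk> \<Longrightarrow>
         \<bar>f y - f x - f' x * (y - x)\<bar> \<le> e' * \<bar>y - x\<bar>"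
      by metis
    obtain \<delta> where "0 < \<delta>" and \<delta>: "\<And>p. p tagged_partial_division_of {a..b} \<Longrightarrow>
        (\<Sum>(x, K)\<in>p. Sup K - Inf K) < \<delta> \<Longrightarrow> (\<Sum>(x, K)\<in>p. \<bar>f (Sup K) - f (Inf K)\<bar>) < e / 2"
      by (rule abs_continuous_on_tagged_sum[OF ac half_gt_zero[OF \<open>0 < e\<close>]]) (rule that)
    obtain U where U: "open U" "N \<subseteq> U" "U \<in> lmeasurable" "measure lebesgue U < \<delta>"
    proof -
      obtain U where U: "open U" "N \<subseteq> U" "U - N \<in> lmeasurable" "emeasure lebesgue (U - N) < ennreal \<delta>"
        using sets_lebesgue_outer_open[of N \<delta>] N \<open>0 < \<delta>\<close>
        by (auto simp: negligible_imp_sets)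
      have N': "N \<in> lmeasurable" "N \<in> null_sets lebesgue"
        using N by (auto simp: negligible_imp_measurable negligible_iff_null_sets)
      have "(U - N) \<union> N \<in> lmeasurable" using U(3) N'(1) by (rule fmeasurable.Un)
      moreover have "(U - N) \<union> N = U" using U(2) by auto
      moreover have "measure lebesgue ((U - N) \<union> N) = measure lebesgue (U - N)"
        using U(3) N'(2) by (intro measure_Un_null_set) auto
      ultimately have "U \<in> lmeasurable" "measure lebesgue U = measure lebesgue (U - N)"
        by simp_all
      then show thesis
        using that[of U] U \<open>0 < \<delta>\<close> by (simp add: emeasure_eq_measure2 ennreal_less_iff)
    qed
    have "\<exists>r>0. x \<in> U \<longrightarrow> ball x r \<subseteq> U" for x
      using \<open>open U\<close> zero_less_one unfolding open_contains_ball by blast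
    then obtain r where r: "\<And>x. 0 < r x" "\<And>x. x \<in> U \<Longrightarrow> ball x (r x) \<subseteq> U" by metis
    define \<gamma> where "\<gamma> x = ball x (min (d x) (r x))" for x
    show "\<exists>\<gamma>. gauge \<gamma> \<and> (\<forall>p. p tagged_division_of {a..b} \<and> \<gamma> fine p \<longrightarrow>
            norm ((\<Sum>(x, K)\<in>p. measure lborel K *\<^sub>R g x) - (f b - f a)) < e)"
    proof (intro exI[of _ \<gamma>] conjI allI impI)
      show "gauge \<gamma>" using d(1) r(1) by (auto simp: \<gamma>_def[abs_def] intro!: gauge_ball_dependent)
      fix p assume *: "p tagged_division_of {a..b} \<and> \<gamma> fine p"
      then have p: "p tagged_division_of {a..b}" and fine: "\<gamma> fine p" by auto
      have fin: "finite p" using p by blast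
      have cb: "\<exists>u v. K = {u..v} \<and> u \<le> x \<and> x \<le> v \<and> a \<le> u \<and> v \<le> b" if xK: "(x, K) \<in> p" for x K
      proof -
        obtain u v where uv: "K = {u..v}" 
          using tagged_division_ofD(4)[OF p xK] by auto
        then have "u \<le> x" "x \<le> v" using tagged_division_ofD(2)[OF p xK] by auto
        moreover have "a \<le> u" "v \<le> b"
          using tagged_division_ofD(3)[OF p xK] uv \<open>u \<le> x\<close> \<open>x \<le> v\<close> by auto
        ultimately show ?thesis using uv by auto
      qed
      define q where "q = {z \<in> p. fst z \<in> N}"
      have q: "q tagged_partial_division_of {a..b}"
        using p unfolding tagged_division_of_def q_def
        by (auto intro: tagged_partial_division_subset)
      have "(\<Sum>(x, K)\<in>q. Sup K - Inf K) \<le> measure lebesgue U"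
      proof (rule sum_measure_tagged_partial_division[OF q])
        show "K \<subseteq> U" if "(x, K) \<in> q" for x K
        proof -
          have "K \<subseteq> \<gamma> x" using that fine by (auto simp: q_def fine_def)
          also have "\<dots> \<subseteq> ball x (r x)" by (auto simp: \<gamma>_def)
          also have "\<dots> \<subseteq> U" using that U r by (auto simp: q_def)
          finally show ?thesis .
        qed
      qed fact
      with U have "(\<Sum>(x, K)\<in>q. Sup K - Inf K) < \<delta>" by simp
      from \<delta>[OF q this] have bad: "(\<Sum>(x, K)\<in>q. \<bar>f (Sup K) - f (Inf K)\<bar>) < e / 2" .
      have tele: "b - a = (\<Sum>(x,K)\<in>p. Sup K - Inf K)" "f b - f a = (\<Sum>(x,K)\<in>p. f(Sup K) - f(Inf K))"
        using additive_tagged_division_1[where f= "\<lambda>x. x"] additive_tagged_division_1[where f= f]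
          ab p by auto
      have "norm ((\<Sum>(x, K)\<in>p. measure lborel K *\<^sub>R g x) - (f b - f a)) =
            norm (\<Sum>(x, K)\<in>p. measure lborel K * g x - (f (Sup K) - f (Inf K)))"
        by (simp add: tele sum_subtractf case_prod_unfold)
      also have "\<dots> \<le> (\<Sum>(x, K)\<in>p. e' * (Sup K - Inf K) + (if x \<in> N then \<bar>f (Sup K) - f (Inf K)\<bar> else 0))"
      proof (rule sum_norm_le, clarify)
        fix x K assume xK: "(x, K) \<in> p"
        then obtain u v where K: "K = {u..v}" "u \<le> x" "x \<le> v" "a \<le> u" "v \<le> b" using cb by blast
        show "norm (measure lborel K * g x - (f (Sup K) - f (Inf K)))
           \<le> e' * (Sup K - Inf K) + (if x \<in> N then \<bar>f (Sup K) - f (Inf K)\<bar> else 0)"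
        proof (cases "x \<in> N")
          case True
          moreover have "0 \<le> e' * (v - u)" using K \<open>0 < e'\<close> by simp
          ultimately show ?thesis using K by (simp add: g_def abs_minus_commute)
        next
          case False
          have "{u..v} \<subseteq> \<gamma> x" using xK fine K by (auto simp: fine_def)
          moreover have "u \<in> {u..v}" "v \<in> {u..v}" using K by auto
          ultimately have "u \<in> \<gamma> x" "v \<in> \<gamma> x" by blast+
          then have "\<bar>u - x\<bar> < d x" "\<bar>v - x\<bar> < d x" by (auto simp: \<gamma>_def dist_real_def)
          then have "\<bar>f u - f x - f' x * (u - x)\<bar> \<le> e' * \<bar>u - x\<bar>"
            "\<bar>f v - f x - f' x * (v - x)\<bar> \<le> e' * \<bar>v - x\<bar>"
            using d(2)[of x u] d(2)[of x v] K False by auto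
          then have "\<bar>(v - u) * f' x - (f v - f u)\<bar> \<le> e' * (x - u) + e' * (v - x)"
            using K by (simp add: algebra_simps abs_le_iff)
          then show ?thesis using K False by (simp add: g_def algebra_simps)
        qed
      qed
      also have "\<dots> = e' * (b - a) + (\<Sum>(x, K)\<in>q. \<bar>f (Sup K) - f (Inf K)\<bar>)"
        using fin unfolding tele(1) q_def
        by (simp add: sum.distrib sum_distrib_left case_prod_unfold sum.inter_filter)
      also have "\<dots> < e" using bad \<open>e' * (b - a) < e / 2\<close> by simp
      finally show "norm ((\<Sum>(x, K)\<in>p. measure lborel K *\<^sub>R g x) - (f b - f a)) < e" .
    qed
  qed
  then show ?thesis
    by (rule has_integral_spike[OF N, rotated]) (auto simp: g_def)
qed

section \<open>The lower bound on the makespan\<close>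

text \<open>
  Here \<open>max 0\<close> in the rate is used: it never makes the temperature grow more slowly than the linear law
  \<open>a * (1 - s) + b * s\<close>.
\<close>

lemma temperature_ge:
  assumes T: "is_temperature a b s T" and s: "s integrable_on {0..c}" and "0 \<le> c"
  shows "a * c + (b - a) * integral {0..c} s \<le> T c"
proof -
  have ae: "AE t in lebesgue. 0 \<le> t \<longrightarrow>
        (T has_real_derivative temp_rate a b (s t) (T t)) (at t within {0..})"
    and ac: "abs_continuous_on {0..c} T" and "T 0 = 0"
    using T \<open>0 \<le> c\<close> by (auto simp: is_temperature_def)
  obtain N where N: "N \<in> null_sets lebesgue" "{t. \<not> (0 \<le> t \<longrightarrow>
        (T has_real_derivative temp_rate a b (s t) (T t)) (at t within {0..}))} \<subseteq> N"
    using ae by (auto simp: eventually_ae_filter)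
  have rate: "((\<lambda>t. temp_rate a b (s t) (T t)) has_integral (T c - T 0)) {0..c}"
  proof (rule fundamental_theorem_of_calculus_abs_continuous[OF \<open>0 \<le> c\<close> ac])
    show "negligible N" using N by (simp add: negligible_iff_null_sets)
    show "(T has_real_derivative temp_rate a b (s x) (T x)) (at x within {0..c})"
      if "x \<in> {0..c} - N" for x
      by (rule DERIV_subset[of _ _ _ "{0..}"]) (use N that in auto)
  qed
  have free: "((\<lambda>t. a + (b - a) * s t) has_integral (a * c + (b - a) * integral {0..c} s)) {0..c}"
    using has_integral_add[OF has_integral_const_real[of a 0 c]
        has_integral_mult_right[OF integrable_integral[OF s], of "b - a"]] \<open>0 \<le> c\<close>
    by (simp add: mult.commute)
  have "a * c + (b - a) * integral {0..c} s \<le> T c - T 0"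
    by (rule has_integral_le[OF free rate]) (auto simp: temp_rate_def algebra_simps)
  then show ?thesis using \<open>T 0 = 0\<close> by simp
qed

text \<open>
  The definition by \<open>LEAST\<close> is meaningful because the work done is continuous in time, so that the
  minimum is attained on a compact interval.
\<close>

lemma completion_time_least:
  assumes s: "\<And>t. 0 \<le> t \<Longrightarrow> S j integrable_on {0..t}"
    and ex: "\<exists>t\<ge>0. p j \<le> integral {0..t} (S j)"
  shows "0 \<le> completion_time p S j" "p j \<le> integral {0..completion_time p S j} (S j)"
    and "\<And>t. 0 \<le> t \<Longrightarrow> p j \<le> integral {0..t} (S j) \<Longrightarrow> completion_time p S j \<le> t"
proof -
  obtain u where u: "0 \<le> u" "p j \<le> integral {0..u} (S j)" using ex by auto
  let ?A = "{t \<in> {0..u}. p j \<le> integral {0..t} (S j)}"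
  have "continuous_on {0..u} (\<lambda>t. integral {0..t} (S j))"
    by (intro indefinite_integral_continuous_1 s) (use u in auto)
  then have "closed ?A"
    by (intro continuous_on_closed_Collect_le) auto
  then have "compact ?A" 
    by (auto simp: compact_eq_bounded_closed intro: bounded_subset[of "{0..u}"])
  moreover have "?A \<noteq> {}" using u by auto
  ultimately obtain x where x: "x \<in> ?A" "\<And>y. y \<in> ?A \<Longrightarrow> x \<le> y"
    by (meson compact_attains_inf)
  have min: "x \<le> t" if "0 \<le> t" "p j \<le> integral {0..t} (S j)" for t
    using that x by (cases "t \<le> u") auto
  have "completion_time p S j = x"
    unfolding completion_time_def by (rule Least_equality) (use x min in auto)
  then show "0 \<le> completion_time p S j" "p j \<le> integral {0..completion_time p S j} (S j)"
    "\<And>t. 0 \<le> t \<Longrightarrow> p j \<le> integral {0..t} (S j) \<Longrightarrow> completion_time p S j \<le> t"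
    using x min by auto
qed

text \<open>
  The second argument of the maximum is the solution \<open>t\<close> of \<open>a * t + (b - a) * p = 1\<close>. It exceeds \<open>p\<close>
  exactly if running the job without interruption would heat it above 1.
\<close>

definition single_job_bound :: "real \<Rightarrow> real \<Rightarrow> real \<Rightarrow> real" where
  "single_job_bound p a b = max p ((1 - (b - a) * p) / a)"

lemma makespan_ge:
  assumes fs: "feasible m J \<alpha> \<beta> S" and co: "completes J p S" and v: "valid_input m J p \<alpha> \<beta>"
  shows "max (MAX j\<in>J. single_job_bound (p j) (\<alpha> j) (\<beta> j)) ((\<Sum>j\<in>J. p j) / real m) \<le> makespan J p S"
proof -
  have fin: "finite J" "J \<noteq> {}" "1 \<le> m"
    and pos: "\<And>j. j \<in> J \<Longrightarrow> 0 < p j" "\<And>j. j \<in> J \<Longrightarrow> \<alpha> j < 0" "\<And>j. j \<in> J \<Longrightarrow> 0 < \<beta> j"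
    using v by (auto simp: valid_input_def)
  have int: "S j integrable_on {0..t}" if "j \<in> J" "0 \<le> t" for j t
    using fs that by (auto simp: feasible_def is_schedule_def intro: set_lebesgue_integral_eq_integral(1))
  have S: "0 \<le> S j t" "S j t \<le> 1" "(\<Sum>j\<in>J. S j t) \<le> real m" if "j \<in> J" "0 \<le> t" for j t
    using fs that by (auto simp: feasible_def is_schedule_def manageable_def)
  note ct = completion_time_least[of S _ p, OF int]
  have ex: "\<exists>t\<ge>0. p j \<le> integral {0..t} (S j)" if "j \<in> J" for j
    using co that by (auto simp: completes_def)
  let ?M = "makespan J p S"
  have leM: "completion_time p S j \<le> ?M" if "j \<in> J" for j
    unfolding makespan_def using fin that by (intro Max_ge) auto
  have "0 \<le> ?M" using fin leM ct(1)[OF _ _ ex] by (meson all_not_in_conv order_trans)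
  have work: "p j \<le> integral {0..?M} (S j)" if "j \<in> J" for j
  proof -
    have "p j \<le> integral {0..completion_time p S j} (S j)" using ct(2) ex that by auto
    also have "\<dots> \<le> integral {0..?M} (S j)"
      by (rule integral_subset_le) (use leM int S that \<open>0 \<le> ?M\<close> ct(1)[OF _ _ ex] in auto)
    finally show ?thesis .
  qed
  have "single_job_bound (p j) (\<alpha> j) (\<beta> j) \<le> ?M" if j: "j \<in> J" for j
  proof -
    let ?W = "integral {0..?M} (S j)"
    have "?W \<le> integral {0..?M} (\<lambda>_. 1)"
      by (rule integral_le) (use int S j \<open>0 \<le> ?M\<close> in auto)
    then have "p j \<le> ?M" using work[OF j] \<open>0 \<le> ?M\<close> by simp
    obtain T where T: "is_temperature (\<alpha> j) (\<beta> j) (S j) T" "T ?M \<le> 1"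
      using fs j \<open>0 \<le> ?M\<close> by (auto simp: feasible_def)
    have "(\<beta> j - \<alpha> j) * p j \<le> (\<beta> j - \<alpha> j) * ?W"
      using work[OF j] pos[OF j] by (intro mult_left_mono) auto
    with temperature_ge[OF T(1) int[OF j \<open>0 \<le> ?M\<close>] \<open>0 \<le> ?M\<close>] T(2)
    have "\<alpha> j * ?M + (\<beta> j - \<alpha> j) * p j \<le> 1" by linarith
    then have "(1 - (\<beta> j - \<alpha> j) * p j) / \<alpha> j \<le> ?M"
      using pos[OF j] by (simp add: field_simps)
    with \<open>p j \<le> ?M\<close> show ?thesis by (simp add: single_job_bound_def)
  qed
  moreover have "(\<Sum>j\<in>J. p j) / real m \<le> ?M"
  proof -
    have "(\<Sum>j\<in>J. p j) \<le> (\<Sum>j\<in>J. integral {0..?M} (S j))" by (rule sum_mono) (rule work)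
    also have "\<dots> = integral {0..?M} (\<lambda>t. \<Sum>j\<in>J. S j t)"
      using fin int \<open>0 \<le> ?M\<close> by (subst integral_sum) auto
    also have "\<dots> \<le> integral {0..?M} (\<lambda>_. real m)"
      by (rule integral_le) (use int S fin \<open>0 \<le> ?M\<close> in \<open>auto intro!: integrable_sum\<close>)
    also have "\<dots> = real m * ?M" using \<open>0 \<le> ?M\<close> by simp
    finally show ?thesis using fin by (simp add: field_simps)
  qed
  ultimately show ?thesis using fin by simp
qed

section \<open>Temperatures of on-off loads\<close>

lemma lipschitz_imp_abs_continuous_on:
  fixes f :: "real \<Rightarrow> real"
  assumes L: "\<And>x y. x \<in> I \<Longrightarrow> y \<in> I \<Longrightarrow> x \<le> y \<Longrightarrow> \<bar>f y - f x\<bar> \<le> L * (y - x)" and "0 < L"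
  shows "abs_continuous_on I f"
  unfolding abs_continuous_on_def
proof (intro allI impI)
  fix e :: real assume "0 < e"
  show "\<exists>d>0. \<forall>D :: (real \<times> real) set.
        finite D \<and> (\<forall>(x, y)\<in>D. x \<le> y \<and> {x..y} \<subseteq> I) \<and>
        disjoint_family_on (\<lambda>(x, y). {x<..<y}) D \<and> (\<Sum>(x, y)\<in>D. y - x) < d
        \<longrightarrow> (\<Sum>(x, y)\<in>D. \<bar>f y - f x\<bar>) < e"
  proof (intro exI[of _ "e / L"] conjI allI impI)
    show "0 < e / L" using \<open>0 < e\<close> \<open>0 < L\<close> by simp
    fix D :: "(real \<times> real) set"
    assume D: "finite D \<and> (\<forall>(x, y)\<in>D. x \<le> y \<and> {x..y} \<subseteq> I) \<and>
        disjoint_family_on (\<lambda>(x, y). {x<..<y}) D \<and> (\<Sum>(x, y)\<in>D. y - x) < e / L"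
    have "(\<Sum>(x, y)\<in>D. \<bar>f y - f x\<bar>) \<le> (\<Sum>(x, y)\<in>D. L * (y - x))"
    proof (rule sum_mono, clarify)
      fix x y assume "(x, y) \<in> D"
      then have "x \<le> y" "{x..y} \<subseteq> I" using D by auto
      then show "\<bar>f y - f x\<bar> \<le> L * (y - x)" by (intro L) auto
    qed
    also have "\<dots> = L * (\<Sum>(x, y)\<in>D. y - x)"
      by (simp add: sum_distrib_left case_prod_unfold)
    also have "\<dots> < e" using D \<open>0 < L\<close> by (simp add: field_simps)
    finally show "(\<Sum>(x, y)\<in>D. \<bar>f y - f x\<bar>) < e" .
  qed
qed

text \<open>
  These are the moments at which a cooling job reaches temperature 0, where the temperature has a kink.
  Each of them is the right end of an interval on which the function is positive; a rational number in
  that interval determines it.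
\<close>

lemma countable_zeros_after_positive:
  fixes f :: "real \<Rightarrow> real"
  shows "countable {t. f t = 0 \<and> (\<exists>u<t. \<forall>x. u < x \<and> x < t \<longrightarrow> 0 < f x)}" (is "countable ?B")
proof -
  define P where "P t q \<longleftrightarrow> q \<in> \<rat> \<and> q < t \<and> (\<forall>x. q \<le> x \<and> x < t \<longrightarrow> 0 < f x)" for t q
  have ex: "\<exists>q. P t q" if t: "t \<in> ?B" for t
  proof -
    obtain u where u: "u < t" "\<forall>x. u < x \<and> x < t \<longrightarrow> 0 < f x" using t by auto
    obtain q where "q \<in> \<rat>" "u < q" "q < t" using Rats_dense_in_real[OF u(1)] by auto
    then show ?thesis using u(2) unfolding P_def by (intro exI[of _ q]) auto
  qed
  define q where "q t = (SOME q. P t q)" for t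
  have "P t (q t)" if "t \<in> ?B" for t using someI_ex[OF ex[OF that]] by (simp add: q_def)
  then have q: "\<And>t. t \<in> ?B \<Longrightarrow> q t \<in> \<rat>" "\<And>t. t \<in> ?B \<Longrightarrow> q t < t"
    "\<And>t x. t \<in> ?B \<Longrightarrow> q t \<le> x \<Longrightarrow> x < t \<Longrightarrow> 0 < f x" unfolding P_def by blast+
  have inj: "inj_on q ?B"
  proof (rule linorder_inj_onI)
    fix s t assume st: "s < t" "s \<in> ?B" "t \<in> ?B"
    show "q s \<noteq> q t"
    proof
      assume "q s = q t"
      then have "0 < f s" using q(3)[OF st(3), of s] q(2)[OF st(2)] st(1) by simp
      then show False using st(2) by simp
    qed
  qed auto
  have "countable (q ` ?B)"
    by (rule countable_subset[OF _ countable_rat]) (use q(1) in blast)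
  then show ?thesis using inj by (rule countable_image_inj_on)
qed

text \<open>
  The exceptional set \<open>D\<close> contains the switching times.
\<close>

locale on_off_load =
  fixes a b :: real and s :: "real \<Rightarrow> real" and D :: "real set"
  assumes a: "a < 0" and b: "0 < b"
    and on_off: "s t \<in> {0, 1}"
    and integrable: "0 \<le> u \<Longrightarrow> s integrable_on {u..v}"
    and countable: "countable D"
    and locally_constant: "t \<notin> D \<Longrightarrow> \<forall>\<^sub>F x in at t. s x = s t"
begin

definition free_temp :: "real \<Rightarrow> real" where
  "free_temp t = a * t + (b - a) * integral {0..t} s"

text \<open>
  This is the free temperature minus its running minimum, which is how reflection at 0 acts on a
  path (Skorokhod's reflection map). In this form an upper bound on the temperature is an upper bound
  on increments of the free temperature.
\<close>

definition temp :: "real \<Rightarrow> real" where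
  "temp t = (SUP u\<in>{0..t}. free_temp t - free_temp u)"

lemma free_temp_diff:
  assumes "0 \<le> u" "u \<le> v"
  shows "free_temp v - free_temp u = a * (v - u) + (b - a) * integral {u..v} s"
proof -
  have "integral {0..v} s = integral {0..u} s + integral {u..v} s"
    using assms integrable[of 0 v] by (intro Henstock_Kurzweil_Integration.integral_combine[symmetric]) auto
  then show ?thesis by (simp add: free_temp_def algebra_simps)
qed

lemma free_temp_diff_bounds:
  assumes "0 \<le> u" "u \<le> v"
  shows "a * (v - u) \<le> free_temp v - free_temp u" "free_temp v - free_temp u \<le> b * (v - u)"
proof -
  have nn: "0 \<le> s x" "s x \<le> 1" for x using on_off[of x] by auto
  have "0 \<le> integral {u..v} s"
    using assms integrable nn by (intro integral_nonneg) auto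
  moreover have "integral {u..v} s \<le> integral {u..v} (\<lambda>_. 1)"
    using assms integrable nn by (intro integral_le) auto
  then have "integral {u..v} s \<le> v - u" using assms by simp
  ultimately have "0 \<le> (b - a) * integral {u..v} s" "(b - a) * integral {u..v} s \<le> (b - a) * (v - u)"
    using a b by (auto intro: mult_left_mono)
  then show "a * (v - u) \<le> free_temp v - free_temp u" "free_temp v - free_temp u \<le> b * (v - u)"
    unfolding free_temp_diff[OF assms] by (auto simp: algebra_simps)
qed

lemma free_temp_diff_const:
  assumes "0 \<le> u" "u \<le> v" "\<And>x. u \<le> x \<Longrightarrow> x \<le> v \<Longrightarrow> s x = c"
  shows "free_temp v - free_temp u = (a * (1 - c) + b * c) * (v - u)"
proof -
  have "integral {u..v} s = integral {u..v} (\<lambda>_. c)"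
    using assms by (intro integral_cong) auto
  then have "integral {u..v} s = c * (v - u)" using assms(2) by simp
  then show ?thesis by (simp only: free_temp_diff[OF assms(1,2)]) (simp add: algebra_simps)
qed

lemma temp_upper:
  assumes "0 \<le> u" "u \<le> t"
  shows "free_temp t - free_temp u \<le> temp t"
  unfolding temp_def
proof (rule cSUP_upper)
  show "bdd_above ((\<lambda>u. free_temp t - free_temp u) ` {0..t})"
  proof (rule bdd_aboveI2)
    fix x assume x: "x \<in> {0..t}"
    then have "free_temp t - free_temp x \<le> b * (t - x)" using free_temp_diff_bounds(2)[of x t] by simp
    also have "\<dots> \<le> b * t" using x b by simp
    finally show "free_temp t - free_temp x \<le> b * t" .
  qed
qed (use assms in auto)

lemma temp_least:
  assumes "0 \<le> t" "\<And>u. 0 \<le> u \<Longrightarrow> u \<le> t \<Longrightarrow> free_temp t - free_temp u \<le> z"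
  shows "temp t \<le> z"
  unfolding temp_def using assms by (intro cSUP_least) auto

lemma temp_nonneg: "0 \<le> t \<Longrightarrow> 0 \<le> temp t"
  using temp_upper[of t t] by simp

text \<open>
  The next two lemmas are the flow property: the temperature at \<open>t\<close> is determined by the temperature at
  an earlier moment \<open>w\<close> and the load between \<open>w\<close> and \<open>t\<close>.
\<close>

lemma temp_flow_ge:
  assumes "0 \<le> w" "w \<le> t"
  shows "temp w + (free_temp t - free_temp w) \<le> temp t"
proof -
  have "temp w \<le> temp t - (free_temp t - free_temp w)"
  proof (rule temp_least[OF assms(1)])
    fix u assume "0 \<le> u" "u \<le> w"
    then show "free_temp w - free_temp u \<le> temp t - (free_temp t - free_temp w)"
      using temp_upper[of u t] assms by simp
  qed
  then show ?thesis by simp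
qed

lemma temp_flow_le:
  assumes "0 \<le> w" "w \<le> t" and z: "\<And>u. w \<le> u \<Longrightarrow> u \<le> t \<Longrightarrow> free_temp t - free_temp u \<le> z"
    and wz: "temp w + (free_temp t - free_temp w) \<le> z"
  shows "temp t \<le> z"
proof (rule temp_least)
  fix u assume u: "0 \<le> u" "u \<le> t"
  show "free_temp t - free_temp u \<le> z"
  proof (cases "u \<le> w")
    case True
    then show ?thesis using temp_upper[of u w] u wz by simp
  next
    case False
    then show ?thesis using z u by simp
  qed
qed (use assms in simp)

lemma temp_lipschitz_upper:
  assumes "0 \<le> w" "w \<le> t"
  shows "temp t \<le> temp w + b * (t - w)"
proof (rule temp_flow_le[OF assms])
  fix u assume u: "w \<le> u" "u \<le> t"
  then have "free_temp t - free_temp u \<le> b * (t - u)"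
    using assms by (intro free_temp_diff_bounds) auto
  also have "\<dots> \<le> b * (t - w)" using b u by simp
  also have "\<dots> \<le> temp w + b * (t - w)" using temp_nonneg[OF assms(1)] by simp
  finally show "free_temp t - free_temp u \<le> temp w + b * (t - w)" .
qed (use free_temp_diff_bounds(2)[OF assms] in simp)

lemma temp_lipschitz:
  assumes "0 \<le> w" "w \<le> t"
  shows "\<bar>temp t - temp w\<bar> \<le> (b - a) * (t - w)"
proof -
  have "a * (t - w) \<le> 0" "0 \<le> b * (t - w)" using a b assms by (auto simp: mult_le_0_iff)
  moreover have "temp w + a * (t - w) \<le> temp t"
    using temp_flow_ge[OF assms] free_temp_diff_bounds(1)[OF assms] by simp
  moreover note temp_lipschitz_upper[OF assms]
  ultimately show ?thesis by (simp add: algebra_simps abs_le_iff)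
qed

lemma temp_heating:
  assumes "0 \<le> w" "w \<le> t" and s: "\<And>x. w \<le> x \<Longrightarrow> x \<le> t \<Longrightarrow> s x = 1"
  shows "temp t = temp w + b * (t - w)"
proof (rule antisym)
  show "temp t \<le> temp w + b * (t - w)"
    by (rule temp_lipschitz_upper[OF assms(1,2)])
  show "temp w + b * (t - w) \<le> temp t"
    using temp_flow_ge[OF assms(1,2)] free_temp_diff_const[of w t 1] assms by simp
qed

lemma temp_cooling:
  assumes "0 \<le> w" "w \<le> t" and s: "\<And>x. w \<le> x \<Longrightarrow> x \<le> t \<Longrightarrow> s x = 0"
  shows "temp t = max 0 (temp w + a * (t - w))"
proof (rule antisym)
  show "temp t \<le> max 0 (temp w + a * (t - w))"
  proof (rule temp_flow_le[OF assms(1,2)])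
    fix u assume u: "w \<le> u" "u \<le> t"
    have "free_temp t - free_temp u = a * (t - u)"
      using free_temp_diff_const[of u t 0] u assms by simp
    also have "\<dots> \<le> 0" using a u by (simp add: mult_le_0_iff)
    finally show "free_temp t - free_temp u \<le> max 0 (temp w + a * (t - w))" by simp
  qed (use free_temp_diff_const[of w t 0] assms in simp)
  show "max 0 (temp w + a * (t - w)) \<le> temp t"
    using temp_flow_ge[OF assms(1,2)] free_temp_diff_const[of w t 0] temp_nonneg[of t] assms by simp
qed

text \<open>
  The assumption \<open>reg\<close> excludes the kinks. A moment \<open>t\<close> of temperature 0 with load 0 that is not a kink
  has moments \<open>w < t\<close> of temperature 0 arbitrarily close to it, and from such a \<open>w\<close> on the
  temperature remains 0.
\<close>

lemma temp_deriv:
  assumes t: "0 < t" "t \<notin> D" 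
    and reg: "\<not> (temp t = 0 \<and> (\<exists>u<t. \<forall>x. u < x \<and> x < t \<longrightarrow> 0 < temp x))"
  shows "(temp has_real_derivative temp_rate a b (s t) (temp t)) (at t)"
proof -
  obtain d where d: "0 < d" "\<And>x. dist x t < d \<Longrightarrow> s x = s t"
    using locally_constant[OF t(2)] unfolding eventually_at by (auto, metis)
  \<comment> \<open>The maximum keeps \<open>u\<close> positive, since temperatures are only defined from time 0 on.\<close>
  define u v where "u = max (t / 2) (t - d / 2)" and "v = t + d / 2"
  have uv: "0 < u" "u < t" "t < v" using t d(1) by (auto simp: u_def v_def)
  have const: "s x = s t" if "u \<le> x" "x \<le> v" for x
    using that d by (intro d(2)) (auto simp: u_def v_def dist_real_def)
  consider "s t = 1" | "s t = 0" "0 < temp t" | "s t = 0" "temp t = 0"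
  proof -
    have "s t = 0 \<or> s t = 1" using on_off[of t] by simp
    moreover have "temp t = 0 \<or> 0 < temp t" using temp_nonneg[of t] t by linarith
    ultimately show thesis using that by blast
  qed
  then show ?thesis
  proof cases
    case 1
    have eq: "temp x = temp u + b * (x - u)" if "x \<in> {u<..<v}" for x
      using that uv const 1 by (intro temp_heating) auto
    have "0 \<le> temp u" "0 < b * (t - u)" using temp_nonneg[of u] uv b by auto
    then have "0 < temp t" using eq[of t] uv by simp
    then have rate: "temp_rate a b (s t) (temp t) = b" using 1 by (simp add: temp_rate_def)
    have "((\<lambda>x. temp u + b * (x - u)) has_real_derivative b) (at t)"
      by (auto intro!: derivative_eq_intros)
    then show ?thesis unfolding rate
      by (rule has_field_derivative_transform_within_open[of _ _ _ "{u<..<v}"]) (use eq uv in auto)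
  next
    case 2
    have eq: "temp x = max 0 (temp u + a * (x - u))" if "x \<in> {u<..<v}" for x
      using that uv const 2 by (intro temp_cooling) auto
    let ?O = "{u<..<v} \<inter> {x. 0 < temp u + a * (x - u)}"
    have op: "open ?O" by (auto intro!: open_Collect_less continuous_on_add continuous_on_mult continuous_on_diff)
    have tO: "t \<in> ?O" using eq[of t] uv 2 by (auto simp: max_def split: if_splits)
    have rate: "temp_rate a b (s t) (temp t) = a" using 2 by (simp add: temp_rate_def)
    have "((\<lambda>x. temp u + a * (x - u)) has_real_derivative a) (at t)"
      by (auto intro!: derivative_eq_intros)
    then show ?thesis unfolding rate
      by (rule has_field_derivative_transform_within_open[OF _ op tO]) (use eq in auto)
  next
    case 3
    then have "\<not> (\<forall>x. u < x \<and> x < t \<longrightarrow> 0 < temp x)" using reg uv(2) by blast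
    then obtain w where w: "u < w" "w < t" "\<not> 0 < temp w" by blast
    then have "temp w = 0" using temp_nonneg[of w] uv by simp
    have eq: "temp x = 0" if "x \<in> {w<..<v}" for x
    proof -
      have "temp x = max 0 (temp w + a * (x - w))"
        using that uv w const 3 by (intro temp_cooling) auto
      moreover have "a * (x - w) \<le> 0" using a that by (simp add: mult_le_0_iff)
      ultimately show ?thesis using \<open>temp w = 0\<close> by simp
    qed
    have rate: "temp_rate a b (s t) (temp t) = 0" using 3 a by (simp add: temp_rate_def)
    have "((\<lambda>x. 0) has_real_derivative 0) (at t)" by simp
    then show ?thesis unfolding rate
      by (rule has_field_derivative_transform_within_open[of _ _ _ "{w<..<v}"]) (use eq uv w in auto)
  qed
qed

lemma is_temperature_temp: "is_temperature a b s temp"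
  unfolding is_temperature_def
proof (intro conjI allI impI)
  show "temp 0 = 0" by (simp add: temp_def)
  show "0 \<le> temp t" if "0 \<le> t" for t using that by (rule temp_nonneg)
  show "abs_continuous_on {0..t} temp" for t
    by (rule lipschitz_imp_abs_continuous_on[where L = "b - a"]) (use temp_lipschitz a b in auto)
  define B where "B = {t. temp t = 0 \<and> (\<exists>u<t. \<forall>x. u < x \<and> x < t \<longrightarrow> 0 < temp x)}"
  have "countable (insert 0 (D \<union> B))"
    unfolding B_def by (intro countable_insert countable_Un countable countable_zeros_after_positive)
  then have "insert 0 (D \<union> B) \<in> null_sets lebesgue"
    by (intro null_sets_completionI countable_imp_null_set_lborel)
  then show "AE t in lebesgue. 0 \<le> t \<longrightarrow>
      (temp has_real_derivative temp_rate a b (s t) (temp t)) (at t within {0..})"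
  proof (rule AE_I')
    show "{t \<in> space lebesgue. \<not> (0 \<le> t \<longrightarrow>
       (temp has_real_derivative temp_rate a b (s t) (temp t)) (at t within {0..}))} \<subseteq> insert 0 (D \<union> B)"
    proof (rule subsetI, rule ccontr)
      fix t assume t: "t \<in> {t \<in> space lebesgue. \<not> (0 \<le> t \<longrightarrow>
          (temp has_real_derivative temp_rate a b (s t) (temp t)) (at t within {0..}))}"
        "t \<notin> insert 0 (D \<union> B)"
      then have "(temp has_real_derivative temp_rate a b (s t) (temp t)) (at t)"
        by (intro temp_deriv) (auto simp: B_def)
      then show False using t(1) has_field_derivative_at_within by blast
    qed
  qed
qed

end

section \<open>The wrap-around load\<close>

text \<open>
  An antiderivative of the ceiling function. It is a quadratic polynomial plus a bounded periodic term;
  the polynomial gives the average work of a wrap-around load and the periodic term its fluctuation.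
\<close>

definition ceiling_integral :: "real \<Rightarrow> real" where
  "ceiling_integral z = (z * (z + 1) + frac z * (1 - frac z)) / 2"

lemma ceiling_integral_eq:
  assumes "of_int k - 1 \<le> z" "z \<le> of_int k"
  shows "ceiling_integral z = of_int k * z - of_int k * (of_int k - 1) / 2"
proof (cases "z = of_int k")
  case True
  then show ?thesis by (simp add: ceiling_integral_def field_simps)
next
  case False
  then have "\<lfloor>z\<rfloor> = k - 1" using assms by (intro floor_unique) auto
  then have f: "frac z = z - of_int k + 1" by (simp add: frac_def)
  show ?thesis unfolding ceiling_integral_def f by (simp add: field_simps)
qed

text \<open>
  By this and the previous lemma \<open>ceiling_integral\<close> is the maximum of countably many affine functions,
  hence convex, hence continuous; the definition by \<open>frac\<close> hides this.
\<close>

lemma ceiling_integral_ge: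
  "of_int k * z - of_int k * (of_int k - 1) / 2 \<le> ceiling_integral z"
proof -
  define n where "n = \<lceil>z\<rceil>"
  have n: "of_int n - 1 \<le> z" "z \<le> of_int n" unfolding n_def by linarith+
  have "0 \<le> (of_int n - of_int k) * (z - (of_int n + of_int k - 1) / 2)"
  proof (cases "k < n")
    case True
    then have "of_int k + 1 \<le> (of_int n :: real)" by linarith
    then show ?thesis using n by (intro mult_nonneg_nonneg) (auto simp: field_simps)
  next
    case False
    show ?thesis
    proof (cases "k = n")
      case False
      then have "of_int n + 1 \<le> (of_int k :: real)" using \<open>\<not> k < n\<close> by linarith
      then show ?thesis using n by (intro mult_nonpos_nonpos) (auto simp: field_simps)
    qed simp
  qed
  then show ?thesis unfolding ceiling_integral_eq[OF n] by (simp add: field_simps)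
qed

lemma ceiling_integral_attained:
  "\<exists>k. ceiling_integral z = of_int k * z - of_int k * (of_int k - 1) / 2"
  by (rule exI[of _ "\<lceil>z\<rceil>"], rule ceiling_integral_eq) linarith+

lemma continuous_ceiling_integral: "continuous_on UNIV ceiling_integral"
proof (rule convex_on_continuous)
  show "convex_on UNIV ceiling_integral"
  proof
    fix t x y :: real assume t: "0 < t" "t < 1"
    let ?z = "(1 - t) *\<^sub>R x + t *\<^sub>R y"
    obtain k where k: "ceiling_integral ?z = of_int k * ?z - of_int k * (of_int k - 1) / 2"
      using ceiling_integral_attained by blast
    have "ceiling_integral ?z = (1 - t) * (of_int k * x - of_int k * (of_int k - 1) / 2)
        + t * (of_int k * y - of_int k * (of_int k - 1) / 2)"
      unfolding k by (simp add: field_simps)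
    also have "\<dots> \<le> (1 - t) * ceiling_integral x + t * ceiling_integral y"
      using t by (intro add_mono mult_left_mono ceiling_integral_ge) auto
    finally show "ceiling_integral ?z \<le> (1 - t) * ceiling_integral x + t * ceiling_integral y" .
  qed simp
qed simp

lemma DERIV_ceiling_integral:
  assumes "z \<notin> \<int>"
  shows "(ceiling_integral has_real_derivative of_int \<lceil>z\<rceil>) (at z)"
proof -
  let ?k = "\<lceil>z\<rceil>"
  have "z \<noteq> of_int ?k" using assms by (metis Ints_of_int)
  then have z: "z \<in> {of_int ?k - 1<..<of_int ?k}" using ceiling_correct[of z] by (auto simp: less_le)
  have "((\<lambda>z. of_int ?k * z - of_int ?k * (of_int ?k - 1) / 2) has_real_derivative of_int ?k) (at z)"
    by (auto intro!: derivative_eq_intros)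
  then show ?thesis
    by (rule has_field_derivative_transform_within_open[OF _ _ z]) (auto simp: ceiling_integral_eq[of "\<lceil>z\<rceil>"])
qed

lemma finite_integer_shifts:
  fixes h :: real
  assumes "0 < h"
  shows "finite {t \<in> {u..v}. y - t / h \<in> \<int>}"
proof (rule finite_subset)
  show "{t \<in> {u..v}. y - t / h \<in> \<int>} \<subseteq> (\<lambda>k. h * (y - of_int k)) ` {\<lfloor>y - v / h\<rfloor>..\<lceil>y - u / h\<rceil>}"
  proof
    fix t assume "t \<in> {t \<in> {u..v}. y - t / h \<in> \<int>}"
    then obtain k where k: "y - t / h = of_int k" "u \<le> t" "t \<le> v" by (auto elim: Ints_cases)
    have "y - v / h \<le> of_int k" "of_int k \<le> y - u / h"
      unfolding k(1)[symmetric] using k(2,3) assms by (simp_all add: divide_right_mono)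
    then have "k \<in> {\<lfloor>y - v / h\<rfloor>..\<lceil>y - u / h\<rceil>}" by (auto simp: floor_le_iff le_ceiling_iff)
    moreover have "t = h * (y - of_int k)" using assms unfolding k(1)[symmetric] by simp
    ultimately show "t \<in> (\<lambda>k. h * (y - of_int k)) ` {\<lfloor>y - v / h\<rfloor>..\<lceil>y - u / h\<rceil>}" by blast
  qed
qed simp

lemma has_integral_ceiling_shift:
  fixes h :: real
  assumes h: "0 < h" and "u \<le> v"
  shows "((\<lambda>t. of_int \<lceil>y - t / h\<rceil>) has_integral
    h * (ceiling_integral (y - u / h) - ceiling_integral (y - v / h))) {u..v}"
proof -
  let ?G = "\<lambda>t. - h * ceiling_integral (y - t / h)"
  have "((\<lambda>t. of_int \<lceil>y - t / h\<rceil>) has_integral ?G v - ?G u) {u..v}"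
  proof (rule fundamental_theorem_of_calculus_interior_strong[OF finite_integer_shifts[OF h]])
    fix t assume "t \<in> {u<..<v} - {t \<in> {u..v}. y - t / h \<in> \<int>}"
    then have "y - t / h \<notin> \<int>" by auto
    from DERIV_ceiling_integral[OF this]
    have "(?G has_real_derivative of_int \<lceil>y - t / h\<rceil>) (at t)"
      using h by (auto intro!: derivative_eq_intros DERIV_chain2[of ceiling_integral])
    then show "(?G has_vector_derivative of_int \<lceil>y - t / h\<rceil>) (at t)"
      by (simp add: has_real_derivative_iff_has_vector_derivative)
  next
    show "continuous_on {u..v} ?G"
      using h by (intro continuous_intros continuous_on_compose2[OF continuous_ceiling_integral]) auto
  qed fact
  then show ?thesis by (simp add: algebra_simps)
qed

text \<open>
  The job occupies the segment \<open>[y, y')\<close> of McNaughton's line, measured in slices of length \<open>h\<close>, and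
  the schedule stops at time \<open>C\<close>. The difference of the ceilings counts the integers \<open>k\<close> with
  \<open>y \<le> t / h + k < y'\<close>, that is the machines that process the job at time \<open>t\<close>.
\<close>

definition wrap_load :: "real \<Rightarrow> real \<Rightarrow> real \<Rightarrow> real \<Rightarrow> real \<Rightarrow> real" where
  "wrap_load y y' h C t =
     (if 0 \<le> t \<and> t < C then of_int \<lceil>y' - t / h\<rceil> - of_int \<lceil>y - t / h\<rceil> else 0)"

lemma wrap_load_on_off:
  assumes "y \<le> y'" "y' \<le> y + 1"
  shows "wrap_load y y' h C t \<in> {0, 1}"
proof -
  have "\<lceil>y - t / h\<rceil> \<le> \<lceil>y' - t / h\<rceil>" using assms by (intro ceiling_mono) simp
  moreover have "\<lceil>y' - t / h\<rceil> \<le> \<lceil>y - t / h\<rceil> + 1" using assms by (simp add: ceiling_le_iff) linarith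
  ultimately have "\<lceil>y' - t / h\<rceil> = \<lceil>y - t / h\<rceil> \<or> \<lceil>y' - t / h\<rceil> = \<lceil>y - t / h\<rceil> + 1" by linarith
  then show ?thesis by (auto simp: wrap_load_def)
qed

lemma ceiling_shift_right_continuous:
  fixes h :: real
  assumes "0 < h"
  obtains b where "t < b" "\<And>x. t \<le> x \<Longrightarrow> x < b \<Longrightarrow> \<lceil>y - x / h\<rceil> = \<lceil>y - t / h\<rceil>"
proof
  let ?k = "\<lceil>y - t / h\<rceil>"
  have k: "of_int ?k - 1 < y - t / h" "y - t / h \<le> of_int ?k" by linarith+
  show "t < h * (y - (of_int ?k - 1))" using k assms by (simp add: field_simps)
  fix x assume x: "t \<le> x" "x < h * (y - (of_int ?k - 1))"
  have "t / h \<le> x / h" "x / h < y - (of_int ?k - 1)" using x assms by (auto simp: field_simps)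
  then show "\<lceil>y - x / h\<rceil> = ?k" using k by (intro ceiling_unique) linarith+
qed

lemma wrap_load_half_open:
  assumes h: "0 < h"
  shows "\<exists>I :: (real \<times> real) set. {t. 0 \<le> t \<and> wrap_load y y' h C t = 1} = (\<Union>(a, b)\<in>I. {a..<b})"
    (is "\<exists>I. ?A = _")
proof (intro exI[of _ "{(a, b). {a..<b} \<subseteq> ?A}"] antisym subsetI)
  fix t assume t: "t \<in> ?A"
  then have tC: "0 \<le> t" "t < C" by (auto simp: wrap_load_def split: if_splits)
  obtain c where c: "t < c" "\<And>x. t \<le> x \<Longrightarrow> x < c \<Longrightarrow> \<lceil>y - x / h\<rceil> = \<lceil>y - t / h\<rceil>"
    using ceiling_shift_right_continuous[OF h] by blast
  obtain d where d: "t < d" "\<And>x. t \<le> x \<Longrightarrow> x < d \<Longrightarrow> \<lceil>y' - x / h\<rceil> = \<lceil>y' - t / h\<rceil>"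
    using ceiling_shift_right_continuous[OF h] by blast
  let ?b = "min C (min c d)"
  have "{t..<?b} \<subseteq> ?A"
  proof
    fix x assume x: "x \<in> {t..<?b}"
    then have "wrap_load y y' h C x = wrap_load y y' h C t"
      using c(2)[of x] d(2)[of x] tC by (simp add: wrap_load_def)
    then show "x \<in> ?A" using t x by auto
  qed
  moreover have "t \<in> {t..<?b}" using c d tC by simp
  ultimately show "t \<in> (\<Union>(a, b)\<in>{(a, b). {a..<b} \<subseteq> ?A}. {a..<b})" by blast
qed auto

lemma has_integral_wrap_load:
  assumes h: "0 < h" and uv: "0 \<le> u" "u \<le> v" "v \<le> C"
  shows "(wrap_load y y' h C has_integral
    (y' - y) * (v - u)
    + h * (frac (y' - u / h) * (1 - frac (y' - u / h)) - frac (y' - v / h) * (1 - frac (y' - v / h))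
         - frac (y - u / h) * (1 - frac (y - u / h)) + frac (y - v / h) * (1 - frac (y - v / h))) / 2) {u..v}"
    (is "(_ has_integral ?I) _")
proof -
  have eq: "h * (ceiling_integral (y' - u / h) - ceiling_integral (y' - v / h))
      - h * (ceiling_integral (y - u / h) - ceiling_integral (y - v / h)) = ?I"
    using h by (simp add: ceiling_integral_def field_simps)
  have "((\<lambda>t. of_int \<lceil>y' - t / h\<rceil> - of_int \<lceil>y - t / h\<rceil>) has_integral ?I) {u..v}"
    unfolding eq[symmetric] using uv by (intro has_integral_diff has_integral_ceiling_shift h)
  then show ?thesis
    by (rule has_integral_spike_finite[of "{C}", rotated 2]) (use uv in \<open>auto simp: wrap_load_def\<close>)
qed

lemma frac_product_bounds: "0 \<le> frac z * (1 - frac z)" "frac z * (1 - frac z) \<le> (1 :: real)"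
proof -
  have "0 \<le> frac z" "frac z < 1" by (auto simp: frac_lt_1)
  then show "0 \<le> frac z * (1 - frac z)" "frac z * (1 - frac z) \<le> 1"
    by (auto intro: mult_le_one)
qed

lemma integral_wrap_load_le:
  assumes h: "0 < h" and uv: "0 \<le> u" "u \<le> v" "v \<le> C"
  shows "integral {u..v} (wrap_load y y' h C) \<le> (y' - y) * (v - u) + h"
proof -
  let ?e = "\<lambda>z. frac z * (1 - frac z) :: real"
  have "?e (y' - u / h) - ?e (y' - v / h) - ?e (y - u / h) + ?e (y - v / h) \<le> 2"
    using frac_product_bounds(2)[of "y' - u / h"] frac_product_bounds(1)[of "y' - v / h"]
      frac_product_bounds(1)[of "y - u / h"] frac_product_bounds(2)[of "y - v / h"] by linarith
  then have "h * (?e (y' - u / h) - ?e (y' - v / h) - ?e (y - u / h) + ?e (y - v / h)) \<le> h * 2"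
    using h by (intro mult_left_mono) auto
  then show ?thesis unfolding integral_unique[OF has_integral_wrap_load[OF assms]] by simp
qed

text \<open>
  Over a whole number of slices the fluctuations cancel, so that the job is finished exactly at \<open>C\<close>.
\<close>

lemma integral_wrap_load_total:
  assumes h: "0 < h" and C: "C = of_nat K * h"
  shows "integral {0..C} (wrap_load y y' h C) = (y' - y) * C"
proof -
  have fr: "frac (z - C / h) = frac z" for z
    using h floor_diff_of_int[of z "int K"] by (simp add: C frac_def)
  have "0 \<le> C" using h by (simp add: C)
  then show ?thesis
    using integral_unique[OF has_integral_wrap_load[OF h, of 0 C C y y']] by (simp add: fr)
qed

lemma has_integral_wrap_load_after:
  assumes "C \<le> u"
  shows "(wrap_load y y' h C has_integral 0) {u..v}"
  by (rule has_integral_is_0) (use assms in \<open>auto simp: wrap_load_def\<close>)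

lemma wrap_load_integrable:
  assumes h: "0 < h" and "0 \<le> u"
  shows "wrap_load y y' h C integrable_on {u..v}"
proof -
  consider "v < u" | "u \<le> v" "v \<le> C" | "C \<le> u" | "u \<le> C" "C \<le> v" by linarith
  then show ?thesis
  proof cases
    case 1
    then show ?thesis by (simp add: integrable_on_empty)
  next
    case 2
    then show ?thesis using has_integral_wrap_load[OF h \<open>0 \<le> u\<close>] by blast
  next
    case 3
    then show ?thesis using has_integral_wrap_load_after by blast
  next
    case 4
    have "wrap_load y y' h C integrable_on {u..C}" using has_integral_wrap_load[OF h \<open>0 \<le> u\<close> 4(1)] by blast
    moreover have "wrap_load y y' h C integrable_on {C..v}" using has_integral_wrap_load_after[of C C] by blast
    ultimately show ?thesis using 4 by (intro Henstock_Kurzweil_Integration.integrable_combine[OF 4])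
  qed
qed

lemma wrap_load_locally_constant:
  assumes "t \<notin> {0, C} \<union> {t. y - t / h \<in> \<int>} \<union> {t. y' - t / h \<in> \<int>}"
  shows "\<forall>\<^sub>F x in at t. wrap_load y y' h C x = wrap_load y y' h C t"
proof -
  have lim: "((\<lambda>x. w - x / h) \<longlongrightarrow> w - t / h) (at t)" for w
  proof (cases "h = 0")
    case False
    then show ?thesis by (intro tendsto_intros)
  qed simp
  have "\<forall>\<^sub>F x in at t. \<lceil>y - x / h\<rceil> = \<lceil>y - t / h\<rceil>" "\<forall>\<^sub>F x in at t. \<lceil>y' - x / h\<rceil> = \<lceil>y' - t / h\<rceil>"
    using assms by (auto intro!: eventually_ceiling_eq lim)
  moreover have "\<forall>\<^sub>F x in at t. (x < c) = (t < c)" if "c \<noteq> t" for c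
  proof (cases "t < c")
    case True
    then show ?thesis using order_tendstoD(2)[OF tendsto_ident_at True] by (simp add: eventually_mono)
  next
    case False
    then have "c < t" using that by simp
    from order_tendstoD(1)[OF tendsto_ident_at this] show ?thesis
      by eventually_elim (use False in auto)
  qed
  then have "\<forall>\<^sub>F x in at t. (x < 0) = (t < 0)" "\<forall>\<^sub>F x in at t. (x < C) = (t < C)"
    using assms by auto
  ultimately show ?thesis by eventually_elim (simp add: wrap_load_def not_less[symmetric])
qed

lemma countable_integer_shifts:
  fixes h :: real
  assumes "0 < h"
  shows "countable {t. y - t / h \<in> \<int>}"
proof -
  have "{t. y - t / h \<in> \<int>} \<subseteq> (\<lambda>z. h * (y - z)) ` \<int>"
  proof
    fix t assume "t \<in> {t. y - t / h \<in> \<int>}"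
    then show "t \<in> (\<lambda>z. h * (y - z)) ` \<int>"
      using assms by (intro image_eqI[of _ _ "y - t / h"]) auto
  qed
  then show ?thesis by (rule countable_subset) (intro countable_image countable_int)
qed

section \<open>The minimum makespan\<close>

text \<open>
  Put \<open>r = a + (b - a) * (y' - y)\<close> for the drift of the free temperature. An increment over a time
  interval of length \<open>l\<close> within \<open>[0, C]\<close> is at most \<open>r * l + (b - a) * h\<close>, which is largest for \<open>l = C\<close> or
  for \<open>l = 0\<close>, according to the sign of \<open>r\<close>; the assumptions \<open>total\<close> and \<open>small\<close> cover these two
  cases. After \<open>C\<close> the job cools.
\<close>

lemma wrap_load_feasible_temperature:
  assumes a: "a < 0" and b: "0 < b" and h: "0 < h" and y: "y \<le> y'" "y' \<le> y + 1" and "0 \<le> C"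
    and total: "a * C + (b - a) * ((y' - y) * C) + (b - a) * h \<le> 1" and small: "(b - a) * h \<le> 1"
  shows "\<exists>T. is_temperature a b (wrap_load y y' h C) T \<and> (\<forall>t\<ge>0. T t \<le> 1)"
proof -
  interpret on_off_load a b "wrap_load y y' h C"
      "{0, C} \<union> {t. y - t / h \<in> \<int>} \<union> {t. y' - t / h \<in> \<int>}"
  proof
    show "wrap_load y y' h C t \<in> {0, 1}" for t by (rule wrap_load_on_off[OF y])
    show "wrap_load y y' h C integrable_on {u..v}" if "0 \<le> u" for u v
      by (rule wrap_load_integrable[OF h that])
    show "countable ({0, C} \<union> {t. y - t / h \<in> \<int>} \<union> {t. y' - t / h \<in> \<int>})"
      by (simp add: countable_integer_shifts[OF h])
  qed (use a b in \<open>auto intro!: wrap_load_locally_constant\<close>)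
  define r where "r = a + (b - a) * (y' - y)"
  have core: "free_temp v - free_temp u \<le> 1" if uv: "0 \<le> u" "u \<le> v" "v \<le> C" for u v
  proof -
    have "(b - a) * integral {u..v} (wrap_load y y' h C) \<le> (b - a) * ((y' - y) * (v - u) + h)"
      using a b uv integral_wrap_load_le[OF h uv] by (intro mult_left_mono) auto
    then have le: "free_temp v - free_temp u \<le> r * (v - u) + (b - a) * h"
      unfolding free_temp_diff[OF uv(1,2)] by (simp add: r_def algebra_simps)
    show ?thesis
    proof (cases "r \<le> 0")
      case True
      then have "r * (v - u) \<le> 0" using uv by (simp add: mult_le_0_iff)
      then show ?thesis using le small by linarith
    next
      case False
      then have "r * (v - u) \<le> r * C" using uv by (intro mult_left_mono) auto
      moreover have "r * C + (b - a) * h \<le> 1" using total by (simp add: r_def algebra_simps)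
      ultimately show ?thesis using le by linarith
    qed
  qed
  have after: "free_temp v - free_temp u \<le> 0" if uv: "0 \<le> u" "C \<le> u" "u \<le> v" for u v
    using a uv integral_unique[OF has_integral_wrap_load_after[OF uv(2)]]
    by (simp add: free_temp_diff[OF uv(1,3)] mult_le_0_iff)
  have "temp t \<le> 1" if "0 \<le> t" for t
  proof (rule temp_least[OF that])
    fix u assume u: "0 \<le> u" "u \<le> t"
    consider "t \<le> C" | "C \<le> u" | "u \<le> C" "C \<le> t" by linarith
    then show "free_temp t - free_temp u \<le> 1"
    proof cases
      case 1
      then show ?thesis using core u by simp
    next
      case 2
      then show ?thesis using after[of u t] u by simp
    next
      case 3
      then show ?thesis using core[of u C] after[of C t] u \<open>0 \<le> C\<close> by simp
    qed
  qed
  then show ?thesis using is_temperature_temp by blast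
qed

text \<open>
  The excess \<open>\<epsilon>\<close> over the bound lowers the final temperature by \<open>- \<alpha> j * \<epsilon>\<close>, and the number \<open>K\<close> of
  slices is chosen so large that the fluctuation \<open>(\<beta> j - \<alpha> j) * h\<close> is smaller than that and than 1.
\<close>

lemma exists_schedule_near_bound:
  assumes v: "valid_input m J p \<alpha> \<beta>" and "0 < \<epsilon>"
  defines "B \<equiv> max (MAX j\<in>J. single_job_bound (p j) (\<alpha> j) (\<beta> j)) ((\<Sum>j\<in>J. p j) / real m)"
  shows "\<exists>S. feasible m J \<alpha> \<beta> S \<and> natural_schedule J S \<and> completes J p S \<and> makespan J p S \<le> B + \<epsilon>"
proof -
  have fin: "finite J" "J \<noteq> {}" "1 \<le> m"
    and pos: "\<And>j. j \<in> J \<Longrightarrow> 0 < p j" "\<And>j. j \<in> J \<Longrightarrow> \<alpha> j < 0" "\<And>j. j \<in> J \<Longrightarrow> 0 < \<beta> j"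
    using v by (auto simp: valid_input_def)
  define C where "C = B + \<epsilon>"
  have single: "single_job_bound (p j) (\<alpha> j) (\<beta> j) \<le> B" if "j \<in> J" for j
    unfolding B_def using fin that by (intro max.coboundedI1 Max_ge) auto
  have pB: "p j \<le> B" if "j \<in> J" for j using single[OF that] by (simp add: single_job_bound_def)
  have "0 < B" using fin pB pos(1) by (metis all_not_in_conv less_le_trans)
  then have "0 < C" using \<open>0 < \<epsilon>\<close> by (simp add: C_def)
  have pC: "p j \<le> C" if "j \<in> J" for j using pB[OF that] \<open>0 < \<epsilon>\<close> by (simp add: C_def)
  have sumC: "(\<Sum>j\<in>J. p j) / C \<le> real m"
  proof -
    have "(\<Sum>j\<in>J. p j) / real m \<le> C" using \<open>0 < \<epsilon>\<close> by (auto simp: C_def B_def)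
    then show ?thesis using \<open>0 < C\<close> fin by (simp add: field_simps)
  qed
  have final: "\<alpha> j * C + (\<beta> j - \<alpha> j) * p j \<le> 1 + \<alpha> j * \<epsilon>" if j: "j \<in> J" for j
  proof -
    have "(1 - (\<beta> j - \<alpha> j) * p j) / \<alpha> j \<le> B" using single[OF j] by (simp add: single_job_bound_def)
    then have "\<alpha> j * B \<le> 1 - (\<beta> j - \<alpha> j) * p j" using pos(2)[OF j] by (simp add: field_simps)
    then show ?thesis by (simp add: C_def algebra_simps)
  qed
  have "\<forall>\<^sub>F K in sequentially. \<forall>j\<in>J. (\<beta> j - \<alpha> j) * (C / real K) < min 1 (- \<alpha> j * \<epsilon>)"
  proof (rule eventually_ball_finite[OF fin(1)], rule ballI)
    fix j assume j: "j \<in> J"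
    have "(\<lambda>K. (\<beta> j - \<alpha> j) * (C / real K)) \<longlonglongrightarrow> (\<beta> j - \<alpha> j) * 0"
      by (intro tendsto_intros lim_const_over_n)
    moreover have "0 < min 1 (- \<alpha> j * \<epsilon>)"
      using pos(2)[OF j] \<open>0 < \<epsilon>\<close> by (simp add: mult_neg_pos)
    ultimately show "\<forall>\<^sub>F K in sequentially. (\<beta> j - \<alpha> j) * (C / real K) < min 1 (- \<alpha> j * \<epsilon>)"
      by (intro order_tendstoD(2)) auto
  qed
  then obtain K where K: "1 \<le> K" "\<And>j. j \<in> J \<Longrightarrow> (\<beta> j - \<alpha> j) * (C / real K) < min 1 (- \<alpha> j * \<epsilon>)"
    using eventually_happens'[OF sequentially_bot eventually_conj[OF eventually_ge_at_top]] by blast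
  define h where "h = C / real K"
  have h: "0 < h" "C = real K * h" using K \<open>0 < C\<close> by (auto simp: h_def)
  obtain f where f: "bij_betw f {0..<card J} J" using ex_bij_betw_nat_finite[OF fin(1)] by blast
  \<comment> \<open>The jobs are lined up in the order given by \<open>f\<close>; \<open>Y k\<close> is where the segment of job number \<open>k\<close> begins.\<close>
  define i where "i = the_inv_into {0..<card J} f"
  define Y where "Y k = (\<Sum>l<k. p (f l)) / C" for k
  define S where "S j = wrap_load (Y (i j)) (Y (Suc (i j))) h C" for j
  have fi: "f (i j) = j" "i j < card J" if "j \<in> J" for j
    using f that f_the_inv_into_f_bij_betw[OF f, of j] the_inv_into_into[of f "{0..<card J}" j "{0..<card J}"]
    by (auto simp: i_def bij_betw_def)
  have iF: "i (f k) = k" if "k < card J" for k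
    using f that by (auto simp: i_def bij_betw_def the_inv_into_f_f)
  have width: "Y (Suc (i j)) - Y (i j) = p j / C" if "j \<in> J" for j
    using fi[OF that] by (simp add: Y_def add_divide_distrib)
  have wid: "Y (i j) \<le> Y (Suc (i j))" "Y (Suc (i j)) \<le> Y (i j) + 1" if "j \<in> J" for j
  proof -
    have "0 \<le> p j / C" "p j / C \<le> 1" using pos(1)[OF that] pC[OF that] \<open>0 < C\<close> by auto
    then show "Y (i j) \<le> Y (Suc (i j))" "Y (Suc (i j)) \<le> Y (i j) + 1" using width[OF that] by linarith+
  qed
  have on_off: "S j t \<in> {0, 1}" if "j \<in> J" for j t
    unfolding S_def by (rule wrap_load_on_off[OF wid[OF that]])
  have nn: "0 \<le> S j t" "S j t \<le> 1" if "j \<in> J" for j t using on_off[OF that, of t] by auto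
  have integ: "S j integrable_on {0..t}" for j t
    unfolding S_def using h(1) by (intro wrap_load_integrable) auto
  have load: "(\<Sum>j\<in>J. S j t) \<le> real m" if "0 \<le> t" for t
  proof (cases "t < C")
    case True
    have "(\<Sum>j\<in>J. S j t) = (\<Sum>k\<in>{0..<card J}. S (f k) t)"
      using sum.reindex_bij_betw[OF f, of "\<lambda>j. S j t"] by simp
    also have "\<dots> = (\<Sum>k<card J. of_int \<lceil>Y (Suc k) - t / h\<rceil> - of_int \<lceil>Y k - t / h\<rceil>)"
      using True that by (intro sum.cong) (auto simp: S_def wrap_load_def iF)
    \<comment> \<open>Segments of consecutive jobs are adjacent, so the numbers of busy machines telescope.\<close>
    also have "\<dots> = of_int (\<lceil>Y (card J) - t / h\<rceil> - \<lceil>Y 0 - t / h\<rceil>)"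
      by (simp add: sum_lessThan_telescope[of "\<lambda>k. of_int \<lceil>Y k - t / h\<rceil>"])
    also have "\<dots> \<le> real m"
    proof -
      have "Y (card J) = (\<Sum>j\<in>J. p j) / C"
        using sum.reindex_bij_betw[OF f, of p] by (simp add: Y_def lessThan_atLeast0)
      then have "Y (card J) - t / h \<le> of_int (int m) + (Y 0 - t / h)" using sumC by (simp add: Y_def[of 0])
      then have "\<lceil>Y (card J) - t / h\<rceil> \<le> int m + \<lceil>Y 0 - t / h\<rceil>"
        by (metis add.commute ceiling_add_of_int ceiling_mono)
      then have "\<lceil>Y (card J) - t / h\<rceil> - \<lceil>Y 0 - t / h\<rceil> \<le> int m" by simp
      then show ?thesis by (metis of_int_le_iff of_int_of_nat_eq)
    qed
    finally show ?thesis .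
  qed (simp add: S_def wrap_load_def)
  have work: "p j \<le> integral {0..C} (S j)" if "j \<in> J" for j
    using integral_wrap_load_total[OF h] width[OF that] \<open>0 < C\<close> by (simp add: S_def)
  then have comp: "completes J p S" unfolding completes_def using \<open>0 < C\<close> by (meson less_imp_le)
  have "feasible m J \<alpha> \<beta> S"
    unfolding feasible_def
  proof (intro conjI ballI)
    show "is_schedule J S"
      unfolding is_schedule_def using nn integ by (auto intro!: nonnegative_absolutely_integrable_1)
    show "manageable m J S" unfolding manageable_def using load nn by auto
    fix j assume j: "j \<in> J"
    have "(\<beta> j - \<alpha> j) * h \<le> - \<alpha> j * \<epsilon>" "(\<beta> j - \<alpha> j) * h \<le> 1" using K(2)[OF j] by (auto simp: h_def)
    moreover have "(Y (Suc (i j)) - Y (i j)) * C = p j" using width[OF j] \<open>0 < C\<close> by simp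
    ultimately show "\<exists>T. is_temperature (\<alpha> j) (\<beta> j) (S j) T \<and> (\<forall>t\<ge>0. T t \<le> 1)"
      unfolding S_def using pos[OF j] h wid[OF j] \<open>0 < C\<close> final[OF j]
      by (intro wrap_load_feasible_temperature) auto
  qed
  moreover have "natural_schedule J S"
    unfolding natural_schedule_def
  proof (intro ballI conjI allI impI)
    fix j assume "j \<in> J"
    show "S j t \<in> {0, 1}" for t by (rule on_off) fact
    show "\<exists>I :: (real \<times> real) set. {t. 0 \<le> t \<and> S j t = 1} = (\<Union>(a, b)\<in>I. {a..<b})"
      unfolding S_def by (rule wrap_load_half_open[OF h(1)])
  qed
  moreover have "makespan J p S \<le> C"
    unfolding makespan_def
  proof (rule Max.boundedI)
    fix c assume "c \<in> completion_time p S ` J"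
    then obtain j where j: "j \<in> J" "c = completion_time p S j" by blast
    have "completion_time p S j \<le> C"
      by (rule completion_time_least(3)) (use integ work[OF j(1)] \<open>0 < C\<close> in \<open>auto intro: exI[of _ C]\<close>)
    then show "c \<le> C" using j by simp
  qed (use fin in auto)
  ultimately show ?thesis using comp unfolding C_def by blast
qed

lemma min_makespan_eq_bound:
  assumes v: "valid_input m J p \<alpha> \<beta>"
  shows "min_makespan m J p \<alpha> \<beta> =
    max (MAX j\<in>J. single_job_bound (p j) (\<alpha> j) (\<beta> j)) ((\<Sum>j\<in>J. p j) / real m)"
    (is "_ = ?B")
  unfolding min_makespan_def
proof (rule antisym)
  let ?M = "{makespan J p S | S. feasible m J \<alpha> \<beta> S \<and> natural_schedule J S \<and> completes J p S}"
  have lower: "?B \<le> x" if "x \<in> ?M" for x using that makespan_ge[OF _ _ v] by auto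
  have "?M \<noteq> {}" using exists_schedule_near_bound[OF v zero_less_one] by blast
  then show "?B \<le> Inf ?M" using lower by (intro cInf_greatest)
  show "Inf ?M \<le> ?B"
  proof (rule field_le_epsilon)
    fix \<epsilon> :: real assume "0 < \<epsilon>"
    from exists_schedule_near_bound[OF v this]
    obtain S where S: "feasible m J \<alpha> \<beta> S" "natural_schedule J S" "completes J p S" "makespan J p S \<le> ?B + \<epsilon>"
      by blast
    have "Inf ?M \<le> makespan J p S"
      by (rule cInf_lower) (use S lower in \<open>auto intro!: bdd_belowI\<close>)
    then show "Inf ?M \<le> ?B + \<epsilon>" using S(4) by simp
  qed
qed

lemma min_makespan_single_job:
  assumes v: "valid_input m J p \<alpha> \<beta>" and "j \<in> J"
  shows "min_makespan m {j} p \<alpha> \<beta> = single_job_bound (p j) (\<alpha> j) (\<beta> j)"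
proof -
  have "valid_input m {j} p \<alpha> \<beta>" and "1 \<le> m" "0 < p j" using assms by (auto simp: valid_input_def)
  then have "p j / real m \<le> p j" by (simp add: field_simps)
  also have "\<dots> \<le> single_job_bound (p j) (\<alpha> j) (\<beta> j)" by (simp add: single_job_bound_def)
  finally show ?thesis by (simp add: min_makespan_eq_bound[OF \<open>valid_input m {j} p \<alpha> \<beta>\<close>])
qed

theorem min_makespan_eq:
  assumes v: "valid_input m J p \<alpha> \<beta>"
  shows "min_makespan m J p \<alpha> \<beta> = max (MAX j\<in>J. min_makespan m {j} p \<alpha> \<beta>) ((\<Sum>j\<in>J. p j) / real m)"
  unfolding min_makespan_eq_bound[OF v] using min_makespan_single_job[OF v] by (simp cong: image_cong)

section \<open>A linear-time program for the minimum makespan\<close>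

text \<open>
  Number register 0 collects the maximum of the single-job bounds, register 1 the sum of the processing
  times, and register 7 holds the number of machines. Index register 1 is the position in the input.
  Addresses 4 to 19 are the loop body, in which registers 2, 3 and 4 hold \<open>p\<close>, \<open>\<alpha>\<close>, \<open>\<beta>\<close> of the current job
  and register 5 the second argument of its \<open>single_job_bound\<close>. A maximum is formed by a conditional
  jump over an assignment. Both registers for the constant 1, index register 2 and number register 6,
  are set once. The last three instructions form the average load and the final maximum.
\<close>

definition makespan_program :: program where
  "makespan_program =
    [IConst 2 1, Load 7 1, IAdd 1 1 2, RConst 6 1,
     Load 2 1, IAdd 1 1 2, Load 3 1, IAdd 1 1 2, Load 4 1, IAdd 1 1 2,
     RAdd 1 1 2, RSub 5 4 3, RMul 5 5 2, RSub 5 6 5, RDiv 5 5 3,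
     RJumpLess 2 0 17, RMove 0 2, RJumpLess 5 0 19, RMove 0 5, IJumpLess 1 0 4,
     RDiv 1 1 7, RJumpLess 1 0 23, RMove 0 1]"

lemma length_makespan_program: "length makespan_program = 23"
  by (simp add: makespan_program_def)

text \<open>
  Only an upper bound on the number of steps is tracked because the conditional jumps make the exact
  number depend on the data; a machine that has halted stays in its state.
\<close>

definition reaches_within :: "program \<Rightarrow> nat \<Rightarrow> state \<Rightarrow> state \<Rightarrow> bool" where
  "reaches_within P k \<sigma> \<tau> \<longleftrightarrow> (\<exists>l\<le>k. (step P ^^ l) \<sigma> = \<tau>)"

lemma reaches_within_trans:
  assumes "reaches_within P k \<sigma> \<tau>" "reaches_within P l \<tau> \<upsilon>"
  shows "reaches_within P (k + l) \<sigma> \<upsilon>"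
proof -
  obtain k' l' where "k' \<le> k" "(step P ^^ k') \<sigma> = \<tau>" "l' \<le> l" "(step P ^^ l') \<tau> = \<upsilon>"
    using assms by (auto simp: reaches_within_def)
  then show ?thesis unfolding reaches_within_def
    by (intro exI[of _ "l' + k'"]) (simp add: funpow_add)
qed

lemma computes_within_if_reaches:
  assumes "reaches_within P k (initial_state xs) \<sigma>" "halted P \<sigma>" "rreg \<sigma> 0 = y"
  shows "computes_within P xs y k"
proof -
  obtain l where l: "l \<le> k" "(step P ^^ l) (initial_state xs) = \<sigma>" using assms(1) by (auto simp: reaches_within_def)
  have stay: "(step P ^^ n) \<sigma> = \<sigma>" for n
    by (induction n) (use assms(2) in \<open>auto simp: step_def\<close>)
  have "(step P ^^ k) (initial_state xs) = (step P ^^ (k - l)) \<sigma>"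
    using l by (metis comp_apply funpow_add le_add_diff_inverse2)
  then show ?thesis using stay assms by (simp add: computes_within_def)
qed

text \<open>
  Starting the maximum with 0, the initial content of register 0, is harmless because all single-job
  bounds are positive.
\<close>

definition loop_invariant ::
  "nat \<Rightarrow> ('j \<Rightarrow> real) \<Rightarrow> ('j \<Rightarrow> real) \<Rightarrow> ('j \<Rightarrow> real) \<Rightarrow> 'j list \<Rightarrow> nat \<Rightarrow> state \<Rightarrow> bool" where
  "loop_invariant m p \<alpha> \<beta> js k \<sigma> \<longleftrightarrow>
     ireg \<sigma> 0 = 3 * length js + 1 \<and> ireg \<sigma> 1 = 3 * k + 1 \<and> ireg \<sigma> 2 = 1 \<and>
     rreg \<sigma> 0 = Max (insert 0 ((\<lambda>j. single_job_bound (p j) (\<alpha> j) (\<beta> j)) ` set (take k js))) \<and>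
     rreg \<sigma> 1 = (\<Sum>j\<leftarrow>take k js. p j) \<and> rreg \<sigma> 6 = 1 \<and> rreg \<sigma> 7 = real m \<and>
     (\<forall>i < length js. arr \<sigma> (3 * i + 1) = p (js ! i) \<and> arr \<sigma> (3 * i + 2) = \<alpha> (js ! i)
        \<and> arr \<sigma> (3 * i + 3) = \<beta> (js ! i))"

lemma encode_input_nth:
  "i < length js \<Longrightarrow> encode_input m p \<alpha> \<beta> js ! (3 * i + 1) = p (js ! i) \<and>
     encode_input m p \<alpha> \<beta> js ! (3 * i + 2) = \<alpha> (js ! i) \<and>
     encode_input m p \<alpha> \<beta> js ! (3 * i + 3) = \<beta> (js ! i)"
proof (induction js arbitrary: i)
  case (Cons j js)
  then show ?case
    by (cases i) (auto simp: encode_input_def nth_Cons numeral_eq_Suc)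
qed simp

lemma length_encode_input: "length (encode_input m p \<alpha> \<beta> js) = 3 * length js + 1"
  by (induction js) (auto simp: encode_input_def)

lemma reaches_within_max:
  assumes "Suc (pc \<sigma>) < length P" "P ! pc \<sigma> = RJumpLess a b (pc \<sigma> + 2)" "P ! Suc (pc \<sigma>) = RMove b a"
  shows "reaches_within P 2 \<sigma> (\<sigma>\<lparr>pc := pc \<sigma> + 2, rreg := (rreg \<sigma>)(b := max (rreg \<sigma> b) (rreg \<sigma> a))\<rparr>)"
proof (cases "rreg \<sigma> a < rreg \<sigma> b")
  case True
  then have "(step P ^^ 1) \<sigma> = \<sigma>\<lparr>pc := pc \<sigma> + 2, rreg := (rreg \<sigma>)(b := max (rreg \<sigma> b) (rreg \<sigma> a))\<rparr>"
    using assms by (simp add: step_def halted_def branch_def)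
  then show ?thesis unfolding reaches_within_def by (intro exI[of _ 1]) simp
next
  case False
  then have "(step P ^^ 2) \<sigma> = \<sigma>\<lparr>pc := pc \<sigma> + 2, rreg := (rreg \<sigma>)(b := max (rreg \<sigma> b) (rreg \<sigma> a))\<rparr>"
    using assms by (simp add: numeral_2_eq_2 step_def halted_def branch_def set_rreg_def)
  then show ?thesis unfolding reaches_within_def by (intro exI[of _ 2]) simp
qed

lemma step_makespan_program:
  "n < 23 \<Longrightarrow> step makespan_program \<lparr>pc = n, ireg = I, rreg = R, arr = A\<rparr> =
     exec (makespan_program ! n) \<lparr>pc = n, ireg = I, rreg = R, arr = A\<rparr>"
  by (simp add: step_def halted_def length_makespan_program)

lemmas makespan_program_nth = arg_cong[OF makespan_program_def, of "\<lambda>P. P ! n" for n]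

lemma funpow_numeral_apply: "(f ^^ numeral k) x = (f ^^ pred_numeral k) (f x)"
  by (simp add: numeral_eq_Suc funpow_swap1)

lemma makespan_program_initialisation:
  fixes m :: nat and p \<alpha> \<beta> :: "'j \<Rightarrow> real"
  assumes "js \<noteq> []"
  defines "\<sigma> \<equiv> (step makespan_program ^^ 4) (initial_state (encode_input m p \<alpha> \<beta> js))"
  shows "loop_invariant m p \<alpha> \<beta> js 0 \<sigma>" "pc \<sigma> = 4"
proof -
  have 0: "encode_input m p \<alpha> \<beta> js ! 0 = real m" by (simp add: encode_input_def)
  have "\<sigma> = \<lparr>pc = 4, ireg = (\<lambda>_. 0)(0 := 3 * length js + 1, 2 := 1, 1 := 1),
      rreg = (\<lambda>_. 0)(7 := real m, 6 := 1),
      arr = (\<lambda>i. if i < 3 * length js + 1 then encode_input m p \<alpha> \<beta> js ! i else 0)\<rparr>"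
    unfolding \<sigma>_def initial_state_def length_encode_input using 0
    by (simp add: funpow_numeral_apply step_makespan_program makespan_program_nth set_ireg_def set_rreg_def)
  then show "loop_invariant m p \<alpha> \<beta> js 0 \<sigma>" "pc \<sigma> = 4"
    using encode_input_nth[of _ js m p \<alpha> \<beta>] by (simp_all add: loop_invariant_def)
qed

lemma makespan_program_body:
  fixes \<sigma> :: state
  assumes "pc \<sigma> = 4"
  defines "a \<equiv> arr \<sigma>" and "i \<equiv> ireg \<sigma> 1" and "d \<equiv> ireg \<sigma> 2"
  shows "(step makespan_program ^^ 11) \<sigma> = \<sigma>\<lparr>pc := 15, ireg := (ireg \<sigma>)(1 := i + d + d + d),
    rreg := (rreg \<sigma>)(2 := a i, 3 := a (i + d), 4 := a (i + d + d), 1 := rreg \<sigma> 1 + a i,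
      5 := (rreg \<sigma> 6 - (a (i + d + d) - a (i + d)) * a i) / a (i + d))\<rparr>"
proof (cases \<sigma>)
  case (fields n I R A)
  then have "n = 4" using assms by simp
  show ?thesis
    unfolding a_def i_def d_def fields \<open>n = 4\<close>
    by (simp add: funpow_numeral_apply step_makespan_program makespan_program_nth set_ireg_def set_rreg_def)
qed

text \<open>
  The 16 steps are 11 for loading and arithmetic, at most 2 for each of the two maxima, and 1 for the
  jump back.
\<close>

lemma loop_iteration:
  fixes \<sigma> :: state
  assumes inv: "loop_invariant m p \<alpha> \<beta> js k \<sigma>" and k: "k < length js" and pc: "pc \<sigma> = 4"
  shows "\<exists>\<tau>. reaches_within makespan_program 16 \<sigma> \<tau> \<and> loop_invariant m p \<alpha> \<beta> js (Suc k) \<tau>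
    \<and> pc \<tau> = (if Suc k < length js then 4 else 20)"
proof -
  let ?P = makespan_program
  let ?j = "js ! k"
  define \<rho> where "\<rho> = (step ?P ^^ 11) \<sigma>"
  define \<rho>' where "\<rho>' = \<rho>\<lparr>pc := pc \<rho> + 2, rreg := (rreg \<rho>)(0 := max (rreg \<rho> 0) (rreg \<rho> 2))\<rparr>"
  define \<rho>'' where "\<rho>'' = \<rho>'\<lparr>pc := pc \<rho>' + 2, rreg := (rreg \<rho>')(0 := max (rreg \<rho>' 0) (rreg \<rho>' 5))\<rparr>"
  define \<tau> where "\<tau> = step ?P \<rho>''"
  have a: "arr \<sigma> (3 * k + 1) = p ?j" "arr \<sigma> (3 * k + 2) = \<alpha> ?j" "arr \<sigma> (3 * k + 3) = \<beta> ?j"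
    and i: "ireg \<sigma> 1 = 3 * k + 1" "ireg \<sigma> 2 = 1"
    using inv k by (auto simp: loop_invariant_def)
  have \<rho>: "\<rho> = \<sigma>\<lparr>pc := 15, ireg := (ireg \<sigma>)(1 := 3 * k + 4),
    rreg := (rreg \<sigma>)(2 := p ?j, 3 := \<alpha> ?j, 4 := \<beta> ?j, 1 := rreg \<sigma> 1 + p ?j,
      5 := (1 - (\<beta> ?j - \<alpha> ?j) * p ?j) / \<alpha> ?j)\<rparr>"
    using makespan_program_body[OF pc] inv a unfolding \<rho>_def i loop_invariant_def
    by (simp add: add.assoc numeral_eq_Suc)
  have "reaches_within ?P 11 \<sigma> \<rho>" unfolding reaches_within_def \<rho>_def by blast
  moreover have "reaches_within ?P 2 \<rho> \<rho>'" unfolding \<rho>'_def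
    by (rule reaches_within_max) (simp_all add: \<rho> makespan_program_nth length_makespan_program)
  moreover have "reaches_within ?P 2 \<rho>' \<rho>''" unfolding \<rho>''_def
    by (rule reaches_within_max) (simp_all add: \<rho> \<rho>'_def makespan_program_nth length_makespan_program)
  moreover have "reaches_within ?P 1 \<rho>'' \<tau>" unfolding reaches_within_def \<tau>_def
    by (intro exI[of _ 1]) simp
  ultimately have reach: "reaches_within ?P (11 + 2 + 2 + 1) \<sigma> \<tau>" by (blast intro: reaches_within_trans)
  have pc'': "pc \<rho>'' = 19" by (simp add: \<rho> \<rho>'_def \<rho>''_def)
  have exec: "exec (?P ! 19) \<rho>'' = branch (ireg \<rho>'' 1 < ireg \<rho>'' 0) 4 \<rho>''"
    by (simp add: makespan_program_nth)
  have \<tau>: "\<tau> = \<rho>''\<lparr>pc := if Suc k < length js then 4 else 20\<rparr>"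
    unfolding \<tau>_def using inv
    by (simp add: step_def halted_def length_makespan_program pc'' exec branch_def)
      (auto simp: \<rho> \<rho>'_def \<rho>''_def loop_invariant_def)
  let ?b = "\<lambda>j. single_job_bound (p j) (\<alpha> j) (\<beta> j)"
  have Max: "Max (insert 0 (?b ` set (take (Suc k) js))) = max (Max (insert 0 (?b ` set (take k js)))) (?b ?j)"
  proof -
    have "insert 0 (?b ` set (take (Suc k) js)) = insert (?b ?j) (insert 0 (?b ` set (take k js)))"
      using k by (auto simp: take_Suc_conv_app_nth)
    then have "Max (insert 0 (?b ` set (take (Suc k) js))) = max (?b ?j) (Max (insert 0 (?b ` set (take k js))))"
      using Max_insert[of "insert 0 (?b ` set (take k js))" "?b ?j"] by (simp del: Max_insert)
    then show ?thesis by (simp only: max.commute)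
  qed
  have sum: "(\<Sum>j\<leftarrow>take (Suc k) js. p j) = (\<Sum>j\<leftarrow>take k js. p j) + p ?j"
    using k by (simp add: take_Suc_conv_app_nth)
  have \<tau>_regs: "rreg \<tau> 0 = max (rreg \<sigma> 0) (?b ?j)" "ireg \<tau> = (ireg \<sigma>)(1 := 3 * k + 4)"
    "arr \<tau> = arr \<sigma>" "rreg \<tau> 1 = rreg \<sigma> 1 + p ?j" "rreg \<tau> 6 = rreg \<sigma> 6" "rreg \<tau> 7 = rreg \<sigma> 7"
    by (simp_all add: \<tau> \<rho>''_def \<rho>'_def \<rho> single_job_bound_def max.assoc)
  have "loop_invariant m p \<alpha> \<beta> js (Suc k) \<tau>"
    using inv unfolding loop_invariant_def Max sum \<tau>_regs by (elim conjE, intro conjI) simp_all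
  moreover have "pc \<tau> = (if Suc k < length js then 4 else 20)" by (simp add: \<tau>)
  ultimately show ?thesis using reach by auto
qed

lemma loop:
  fixes \<sigma> :: state
  assumes "loop_invariant m p \<alpha> \<beta> js k \<sigma>" "k < length js" "pc \<sigma> = 4"
  shows "\<exists>\<tau>. reaches_within makespan_program (16 * (length js - k)) \<sigma> \<tau>
    \<and> loop_invariant m p \<alpha> \<beta> js (length js) \<tau> \<and> pc \<tau> = 20"
  using assms
proof (induction "length js - k" arbitrary: k \<sigma>)
  case (Suc n)
  obtain \<upsilon> where \<upsilon>: "reaches_within makespan_program 16 \<sigma> \<upsilon>" "loop_invariant m p \<alpha> \<beta> js (Suc k) \<upsilon>"
    "pc \<upsilon> = (if Suc k < length js then 4 else 20)"
    using loop_iteration[OF Suc.prems] by blast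
  have n: "n = length js - Suc k" using Suc by simp
  show ?case
  proof (cases "Suc k < length js")
    case True
    obtain \<tau> where \<tau>: "reaches_within makespan_program (16 * (length js - Suc k)) \<upsilon> \<tau>"
      "loop_invariant m p \<alpha> \<beta> js (length js) \<tau>" "pc \<tau> = 20"
      using Suc.hyps(1)[OF n \<upsilon>(2) True] \<upsilon>(3) True by auto
    have "16 + 16 * (length js - Suc k) = 16 * (length js - k)" using Suc.prems by simp
    then show ?thesis using reaches_within_trans[OF \<upsilon>(1) \<tau>(1)] \<tau> by auto
  next
    case False
    then have "Suc k = length js" "16 * (length js - k) = 16" using Suc.prems by auto
    then show ?thesis using \<upsilon> by auto
  qed
qed simp

lemma makespan_program_computes:
  assumes v: "valid_input m J p \<alpha> \<beta>" and js: "distinct js" "set js = J"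
  shows "computes_within makespan_program (encode_input m p \<alpha> \<beta> js) (min_makespan m J p \<alpha> \<beta>) (16 * card J + 7)"
proof -
  let ?P = makespan_program and ?s = "initial_state (encode_input m p \<alpha> \<beta> js)"
    and ?b = "\<lambda>j. single_job_bound (p j) (\<alpha> j) (\<beta> j)"
  have "finite J" "J \<noteq> {}" using v unfolding valid_input_def by blast+
  then have J: "finite J" "J \<noteq> {}" "length js = card J" "js \<noteq> []"
    using js distinct_card[OF js(1)] by auto
  define \<sigma> where "\<sigma> = (step ?P ^^ 4) ?s"
  have \<sigma>: "reaches_within ?P 4 ?s \<sigma>" unfolding reaches_within_def \<sigma>_def by blast
  obtain \<rho> where \<rho>: "reaches_within ?P (16 * card J) \<sigma> \<rho>" "loop_invariant m p \<alpha> \<beta> js (length js) \<rho>" "pc \<rho> = 20"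
  proof -
    have "loop_invariant m p \<alpha> \<beta> js 0 \<sigma>" "pc \<sigma> = 4"
      unfolding \<sigma>_def by (rule makespan_program_initialisation[OF J(4)])+
    from loop[OF this(1) _ this(2)] show thesis
      using J(4) that unfolding J(3) diff_zero length_greater_0_conv[symmetric] by blast
  qed
  define \<upsilon> where "\<upsilon> = step ?P \<rho>"
  have \<upsilon>: "\<upsilon> = \<rho>\<lparr>pc := 21, rreg := (rreg \<rho>)(1 := rreg \<rho> 1 / rreg \<rho> 7)\<rparr>"
    using \<rho>(3) by (simp add: \<upsilon>_def step_def halted_def length_makespan_program)
      (simp add: makespan_program_nth set_rreg_def)
  have r1: "reaches_within ?P 1 \<rho> \<upsilon>" unfolding reaches_within_def \<upsilon>_def by (intro exI[of _ 1]) simp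
  define \<tau> where "\<tau> = \<upsilon>\<lparr>pc := pc \<upsilon> + 2, rreg := (rreg \<upsilon>)(0 := max (rreg \<upsilon> 0) (rreg \<upsilon> 1))\<rparr>"
  have r2: "reaches_within ?P 2 \<upsilon> \<tau>" unfolding \<tau>_def
    by (rule reaches_within_max) (simp_all add: \<upsilon> makespan_program_nth length_makespan_program)
  have "reaches_within ?P (4 + 16 * card J + 1 + 2) ?s \<tau>"
    using \<sigma> \<rho>(1) r1 r2 by (blast intro: reaches_within_trans)
  moreover have "4 + 16 * card J + 1 + 2 = 16 * card J + 7" by simp
  ultimately have reach: "reaches_within ?P (16 * card J + 7) ?s \<tau>" by (simp only:)
  have halt: "halted ?P \<tau>" by (simp add: halted_def length_makespan_program \<tau>_def \<upsilon>)
  have res: "rreg \<tau> 0 = min_makespan m J p \<alpha> \<beta>"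
  proof -
    have "rreg \<rho> 0 = Max (insert 0 (?b ` J))" "rreg \<rho> 1 = (\<Sum>j\<in>J. p j)" "rreg \<rho> 7 = real m"
      using \<rho>(2) js by (simp_all add: loop_invariant_def sum_list_distinct_conv_sum_set)
    moreover have "0 \<le> Max (?b ` J)"
    proof -
      obtain j where "j \<in> J" using J by blast
      then have "0 \<le> ?b j" using v by (auto simp: valid_input_def single_job_bound_def intro: max.coboundedI1 less_imp_le)
      also have "\<dots> \<le> Max (?b ` J)" using J \<open>j \<in> J\<close> by simp
      finally show ?thesis .
    qed
    ultimately show ?thesis
      unfolding min_makespan_eq_bound[OF v] using J by (simp add: \<tau>_def \<upsilon>)
  qed
  show ?thesis by (rule computes_within_if_reaches[OF reach halt res])
qed

theorem theorem4:
  shows "(\<forall>(m :: nat) (J :: 'j set) (p :: 'j \<Rightarrow> real) (\<alpha> :: 'j \<Rightarrow> real) (\<beta> :: 'j \<Rightarrow> real).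
            valid_input m J p \<alpha> \<beta> \<longrightarrow>
            min_makespan m J p \<alpha> \<beta> =
              max (MAX j\<in>J. min_makespan m {j} p \<alpha> \<beta>) ((\<Sum>j\<in>J. p j) / real m))
       \<and> (\<exists>(P :: program) (time :: nat \<Rightarrow> nat).
            (\<lambda>n. real (time n)) \<in> O(\<lambda>n. real n) \<and>
            (\<forall>(m :: nat) (J :: 'j set) (p :: 'j \<Rightarrow> real) (\<alpha> :: 'j \<Rightarrow> real) (\<beta> :: 'j \<Rightarrow> real)
               (js :: 'j list).
               valid_input m J p \<alpha> \<beta> \<and> distinct js \<and> set js = J \<longrightarrow>
               computes_within P (encode_input m p \<alpha> \<beta> js) (min_makespan m J p \<alpha> \<beta>)
                 (time (card J))))"
proof (intro conjI exI)
  show "\<forall>m (J :: 'j set) p \<alpha> \<beta>. valid_input m J p \<alpha> \<beta> \<longrightarrow>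
      min_makespan m J p \<alpha> \<beta> = max (MAX j\<in>J. min_makespan m {j} p \<alpha> \<beta>) ((\<Sum>j\<in>J. p j) / real m)"
    using min_makespan_eq by blast
  show "(\<lambda>n. real (16 * n + 7)) \<in> O(\<lambda>n. real n)"
  proof (rule bigoI)
    show "\<forall>\<^sub>F n in sequentially. norm (real (16 * n + 7)) \<le> 23 * norm (real n)"
      using eventually_ge_at_top[of 1] by eventually_elim simp
  qed
  show "\<forall>m (J :: 'j set) p \<alpha> \<beta> js. valid_input m J p \<alpha> \<beta> \<and> distinct js \<and> set js = J \<longrightarrow>
      computes_within makespan_program (encode_input m p \<alpha> \<beta> js) (min_makespan m J p \<alpha> \<beta>) (16 * card J + 7)"
    using makespan_program_computes by blast
qed

end
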